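(* Let $1\le p<\infty$, let $m$ be a positive integer with $m<n$, and let $w(x)=|x|^\theta$ on $\mathbb{R}^n$ with $1-n<\theta\le0$. Let $V\in L^1_{loc}(\mathbb{R}^n)$ be non-negative. Then the following are equivalent. (a) For any $\epsilon>0$ there exists $C(\epsilon)>0$ such that for any $\phi\in C_c^\infty(\mathbb{R}^n)$, $$\|V\phi\|_{L^p(w)}^p\le\epsilon\,\|\nabla^m\phi\|_{L^p(w)}^p+C(\epsilon)\|\phi\|_{L^p(w)}^p.$$ (b) $$\lim_{\delta\to0}\ \sup_{x_0\in\mathbb{R}^n}\ \sup\left\{\|V\phi\|_{L^p(w)}:\ \phi\in C_c^\infty(B(x_0,\delta)),\ \|\nabla^m\phi\|_{L^p(w)}\le1\right\}=0.$$
   Context: $\|f\|_{L^p(w)}^p=\int_{\mathbb{R}^n}|f|^pw\,dx$ (possibly $+\infty$). $\nabla^m\phi$ is the collection of all partial derivatives of $\phi$ of order $m$, with $|\nabla^m\phi|$ its Euclidean norm. $C_c^\infty(\Omega)$ is the space of smooth functions with compact support in the open set $\Omega$, and $B(x_0,\delta)$ is the ball of center $x_0$ and radius $\delta$. *)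

theory Defs
  imports "HOL-Analysis.Analysis"
begin

definition partial_deriv :: "'n::finite \<Rightarrow> (real ^ 'n \<Rightarrow> real) \<Rightarrow> real ^ 'n \<Rightarrow> real" where
  "partial_deriv i f x = deriv (\<lambda>t. f (x + t *\<^sub>R axis i 1)) 0"

text \<open>The list \<open>[i1, i2, ..., im]\<close> stands for the operator
  \<open>\<partial>_i1 \<partial>_i2 ... \<partial>_im\<close>, so that the last entry is differentiated first.\<close>

primrec iter_partial :: "'n::finite list \<Rightarrow> (real ^ 'n \<Rightarrow> real) \<Rightarrow> real ^ 'n \<Rightarrow> real" where
  "iter_partial [] f = f"
| "iter_partial (i # ix) f = partial_deriv i (iter_partial ix f)"

text \<open>Total (Frechet) differentiability is required of every iterated partial derivative. It makes
  the next partial derivatives exist (so \<open>deriv\<close> is never applied where it is a junk value) and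
  makes all of them continuous, i.e. this is \<open>C\<^sup>\<infinity>\<close>.\<close>

definition smooth :: "(real ^ 'n::finite \<Rightarrow> real) \<Rightarrow> bool" where
  "smooth f \<longleftrightarrow> (\<forall>ix x. iter_partial ix f differentiable (at x))"

text \<open>Elements of \<open>C_c\<^sup>\<infinity>(\<Omega>)\<close> are identified with their extensions by zero to the whole space.\<close>

definition test_functions :: "(real ^ 'n::finite) set \<Rightarrow> (real ^ 'n \<Rightarrow> real) set" where
  "test_functions \<Omega> =
     {\<phi>. smooth \<phi> \<and> compact (closure {x. \<phi> x \<noteq> 0}) \<and> closure {x. \<phi> x \<noteq> 0} \<subseteq> \<Omega>}"

text \<open>The entries of \<open>\<nabla>\<^sup>m \<phi>\<close> are indexed by \<open>m\<close>-tuples of coordinate directions (the \<open>m\<close>-th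
  gradient as a tensor), so a mixed derivative occurs once for each order of differentiation.\<close>

definition grad_norm :: "nat \<Rightarrow> (real ^ 'n::finite \<Rightarrow> real) \<Rightarrow> real ^ 'n \<Rightarrow> real" where
  "grad_norm m \<phi> x = L2_set (\<lambda>ix. iter_partial ix \<phi> x) {ix. length ix = m}"

text \<open>\<open>Lp_power p w f\<close> is the \<open>p\<close>-th power of the norm of \<open>f\<close> in \<open>L\<^sup>p(w)\<close>, and \<open>Lp_norm p w f\<close> the
  norm itself; both may be infinite.\<close>

definition Lp_power :: "real \<Rightarrow> (real ^ 'n::finite \<Rightarrow> real) \<Rightarrow> (real ^ 'n \<Rightarrow> real) \<Rightarrow> ennreal" where
  "Lp_power p w f = (\<integral>\<^sup>+x. ennreal (\<bar>f x\<bar> powr p * w x) \<partial>lebesgue)"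

definition Lp_norm :: "real \<Rightarrow> (real ^ 'n::finite \<Rightarrow> real) \<Rightarrow> (real ^ 'n \<Rightarrow> real) \<Rightarrow> ennreal" where
  "Lp_norm p w f =
     (if Lp_power p w f = \<infinity> then \<infinity> else ennreal (enn2real (Lp_power p w f) powr (1 / p)))"

text \<open>At the origin \<open>powr\<close> gives the value 0 for every exponent; this changes the weight on a null
  set only.\<close>

definition power_weight :: "real \<Rightarrow> real ^ 'n::finite \<Rightarrow> real" where
  "power_weight \<theta> x = norm x powr \<theta>"

definition locally_integrable :: "(real ^ 'n::finite \<Rightarrow> real) \<Rightarrow> bool" where
  "locally_integrable V \<longleftrightarrow> (\<forall>K. compact K \<longrightarrow> set_integrable lebesgue K V)"

end

theory Submission
  imports Defs
begin

text \<open>Write \<open>w = |x|\<^sup>\<theta>\<close> and \<open>n\<close> for the dimension.  Everything rests on one property of the weight: for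
\<open>- n < \<theta> \<le> 0\<close> the mean of \<open>w\<close> over a ball whose centre is not the origin is at most a constant times
the value of \<open>w\<close> at the centre (the Muckenhoupt condition \<open>A\<^sub>1\<close>, \<open>power_weight_average\<close>).  By
Tonelli's theorem it follows that replacing a function by its averages along the segments
\<open>[x, x + h]\<close> with \<open>|h| < r\<close> is a bounded operation on \<open>L\<^sup>1(w)\<close>, uniformly in \<open>r\<close>
(\<open>weighted_segment_average\<close>).  Integrating along lines in one fixed direction would not do: the
restriction of \<open>w\<close> to lines close to the origin is not uniformly in \<open>A\<^sub>1\<close> when \<open>\<theta> \<le> - 1\<close>.

Two inequalities come out of this operator.  If \<open>\<phi>\<close> lives in a ball of radius \<open>\<delta>\<close> and
\<open>|h| > 2 \<delta>\<close>, then \<open>\<phi>(x)\<close> is minus the integral of the derivative of \<open>\<phi>\<close> along \<open>[x, x + h]\<close>; averaging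
over such \<open>h\<close> gives the Poincare inequality \<open>\<parallel>\<phi>\<parallel> \<le> C \<delta>\<^sup>m \<parallel>\<nabla>\<^sup>m \<phi>\<parallel>\<close> (\<open>weighted_Poincare\<close>).  Averaging
Taylor's formula of order two over all \<open>|h| < r\<close> gives
\<open>\<parallel>\<nabla>\<phi>\<parallel> \<le> C (r \<parallel>\<nabla>\<^sup>2 \<phi>\<parallel> + (1 / r) \<parallel>\<phi>\<parallel>)\<close> and, by iteration and absorption, the smallness of all derivatives
of order \<open>k < m\<close> relative to those of order \<open>m\<close>, up to a multiple of \<open>\<parallel>\<phi>\<parallel>\<close>
(\<open>weighted_interpolation\<close>).

That (a) implies (b) is then immediate: on small balls the term \<open>C(\<epsilon>) \<parallel>\<phi>\<parallel>\<^sup>p\<close> is absorbed by the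
Poincare inequality.  For the converse, (b) gives
\<open>\<parallel>V \<phi>\<parallel>\<^sup>p \<le> \<eta>\<^sup>p \<parallel>\<nabla>\<^sup>m \<phi>\<parallel>\<^sup>p\<close> for \<open>\<phi>\<close> supported in any ball of a fixed radius \<open>\<delta>\<close>, and this is applied to
\<open>\<phi> \<psi>(\<cdot> - a)\<close> for a bump function \<open>\<psi>\<close> on the ball of radius \<open>\<delta>\<close> around the origin.  Integrating over
all centres \<open>a\<close> acts as a continuous partition of unity: the left side becomes
\<open>\<parallel>\<psi>\<parallel>\<^sub>p\<^sup>p \<parallel>V \<phi>\<parallel>\<^sup>p\<close>, and on the right the leading Leibniz term becomes a constant multiple of
\<open>\<eta>\<^sup>p \<parallel>\<psi>\<parallel>\<^sub>p\<^sup>p \<parallel>\<nabla>\<^sup>m \<phi>\<parallel>\<^sup>p\<close>, where the constant depends neither on \<open>\<delta>\<close> nor on \<open>\<psi>\<close>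
(\<open>averaged_energy_of_product\<close>).  The factor \<open>\<parallel>\<psi>\<parallel>\<^sub>p\<^sup>p\<close> cancels, so \<open>\<eta>\<close> can be fixed in terms of \<open>\<epsilon>\<close>
before \<open>\<delta>\<close> and \<open>\<psi>\<close> are chosen; the terms with fewer derivatives on \<open>\<phi>\<close>, whose constants do depend on
\<open>\<psi>\<close>, are removed by interpolation.\<close>

section \<open>Iterated partial derivatives of smooth functions\<close>

lemma has_derivative_line:
  fixes f :: "'a::real_normed_vector \<Rightarrow> real"
  assumes "(f has_derivative D) (at (x + s *\<^sub>R v))"
  shows "((\<lambda>t. f (x + t *\<^sub>R v)) has_real_derivative D v) (at s)"
proof -
  have D: "bounded_linear D" using assms by (rule has_derivative_bounded_linear)
  have "((\<lambda>t. f (x + t *\<^sub>R v)) has_derivative (\<lambda>t. D (t *\<^sub>R v))) (at s)"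
    by (rule has_derivative_compose[of "\<lambda>t. x + t *\<^sub>R v" "\<lambda>t. t *\<^sub>R v" s UNIV f D, simplified])
       (use assms in \<open>auto intro!: derivative_eq_intros\<close>)
  moreover have "(\<lambda>t. D (t *\<^sub>R v)) = (*) (D v)"
    using bounded_linear.linear[OF D] by (auto simp: fun_eq_iff linear_cmul)
  ultimately show ?thesis
    by (simp add: has_field_derivative_def)
qed

lemma smooth_differentiable: "smooth f \<Longrightarrow> f differentiable at x"
  unfolding smooth_def by (metis iter_partial.simps(1))

lemma iter_partial_append:
  "iter_partial (ix @ jx) f = iter_partial ix (iter_partial jx f)"
  by (induction ix) auto

lemma smooth_iter_partial: "smooth f \<Longrightarrow> smooth (iter_partial ix f)"
  unfolding smooth_def by (metis iter_partial_append)

lemma smooth_partial_deriv: "smooth f \<Longrightarrow> smooth (partial_deriv i f)"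
  using smooth_iter_partial[of f "[i]"] by simp

lemma partial_deriv_eqI:
  assumes "((\<lambda>t. f (x + t *\<^sub>R axis i 1)) has_real_derivative d) (at 0)"
  shows "partial_deriv i f x = d"
  unfolding partial_deriv_def by (rule DERIV_imp_deriv[OF assms])

lemma has_derivative_partial_derivs:
  fixes f :: "real ^ 'n \<Rightarrow> real"
  assumes "f differentiable at x"
  shows "(f has_derivative (\<lambda>h. \<Sum>i\<in>UNIV. h $ i * partial_deriv i f x)) (at x)"
proof -
  obtain D where D: "(f has_derivative D) (at x)"
    using assms by (auto simp: differentiable_def)
  interpret D: bounded_linear D using D by (rule has_derivative_bounded_linear)
  have pd: "partial_deriv i f x = D (axis i 1)" for i
    by (rule partial_deriv_eqI, rule has_derivative_line) (simp add: D)
  have "D h = (\<Sum>i\<in>UNIV. h $ i * partial_deriv i f x)" for h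
  proof -
    have "D h = D (\<Sum>i\<in>UNIV. h $ i *\<^sub>R axis i 1)"
      using basis_expansion[of h] by (simp add: scalar_mult_eq_scaleR)
    also have "\<dots> = (\<Sum>i\<in>UNIV. h $ i * partial_deriv i f x)"
      by (simp add: D.sum D.scaleR pd)
    finally show ?thesis .
  qed
  with D show ?thesis by (metis (no_types, lifting) ext)
qed

lemma smooth_has_line_derivative:
  fixes f :: "real ^ 'n \<Rightarrow> real"
  assumes "smooth f"
  shows "((\<lambda>t. f (x + t *\<^sub>R h)) has_real_derivative
           (\<Sum>i\<in>UNIV. h $ i * partial_deriv i f (x + s *\<^sub>R h))) (at s)"
  by (rule has_derivative_line[OF has_derivative_partial_derivs])
     (rule smooth_differentiable[OF assms])

lemma smooth_has_partial_deriv: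
  fixes f :: "real ^ 'n \<Rightarrow> real"
  assumes "smooth f"
  shows "((\<lambda>t. f (x + t *\<^sub>R axis i 1)) has_real_derivative partial_deriv i f x) (at 0)"
proof -
  obtain D where "(f has_derivative D) (at x)"
    using smooth_differentiable[OF assms] by (auto simp: differentiable_def)
  then have *: "((\<lambda>t. f (x + t *\<^sub>R axis i 1)) has_real_derivative D (axis i 1)) (at 0)"
    by (intro has_derivative_line) simp
  then show ?thesis using partial_deriv_eqI[OF *] by simp
qed

lemma smooth_continuous_on: "smooth f \<Longrightarrow> continuous_on A f"
  by (meson continuous_at_imp_continuous_on differentiable_imp_continuous_within smooth_differentiable)

lemma smooth_borel: "smooth f \<Longrightarrow> f \<in> borel_measurable borel"
  by (intro borel_measurable_continuous_onI smooth_continuous_on)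

text \<open>The usual way to recognise a smooth function: it belongs to a family of differentiable functions
that is stable under partial differentiation.\<close>

lemma smooth_coinduct:
  assumes "f \<in> S"
    and diff: "\<And>g x. g \<in> S \<Longrightarrow> g differentiable at x"
    and closed: "\<And>g i. g \<in> S \<Longrightarrow> partial_deriv i g \<in> S"
  shows "smooth f"
proof -
  have "iter_partial ix f \<in> S" for ix
    by (induction ix) (auto simp: \<open>f \<in> S\<close> closed)
  then show ?thesis by (simp add: smooth_def diff)
qed

lemma smooth_const: "smooth (\<lambda>x :: real ^ 'n. c)"
proof (rule smooth_coinduct[where S = "{g. \<exists>c. g = (\<lambda>x. c)}"])
  fix g :: "real ^ 'n \<Rightarrow> real" and i
  assume "g \<in> {g. \<exists>c. g = (\<lambda>x. c)}"
  then show "partial_deriv i g \<in> {g. \<exists>c. g = (\<lambda>x. c)}"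
    by (auto simp: partial_deriv_def fun_eq_iff)
qed auto

text \<open>Only the term in which every derivative falls on \<open>f\<close> is written out, because that is the one term
whose coefficient has to be controlled; of the others it matters that fewer derivatives fall on \<open>f\<close>
and that the list \<open>L\<close> does not depend on \<open>f\<close> and \<open>g\<close>.\<close>

lemma Leibniz_iter_partial:
  "\<exists>L. (\<forall>(jx, kx)\<in>set L. length jx < length ix) \<and>
     (\<forall>f g. smooth f \<longrightarrow> smooth g \<longrightarrow>
        iter_partial ix (\<lambda>x :: real ^ 'n. f x * g x) =
        (\<lambda>x. iter_partial ix f x * g x +
              (\<Sum>(jx, kx)\<leftarrow>L. iter_partial jx f x * iter_partial kx g x)))"
proof (induction ix)
  case Nil
  show ?case by (intro exI[of _ "[]"]) simp
next
  case (Cons i ix)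
  then obtain L :: "('n list \<times> 'n list) list" where
    len: "\<And>jx kx. (jx, kx) \<in> set L \<Longrightarrow> length jx < length ix"
    and eq: "\<And>f g :: real ^ 'n \<Rightarrow> real. smooth f \<Longrightarrow> smooth g \<Longrightarrow>
        iter_partial ix (\<lambda>x. f x * g x) =
        (\<lambda>x. iter_partial ix f x * g x +
              (\<Sum>(jx, kx)\<leftarrow>L. iter_partial jx f x * iter_partial kx g x))"
    by fast
  let ?L = "(ix, [i]) # map (\<lambda>(jx, kx). (i # jx, kx)) L @ map (\<lambda>(jx, kx). (jx, i # kx)) L"
  show ?case
  proof (intro exI[of _ ?L] conjI allI impI)
    show "\<forall>(jx, kx)\<in>set ?L. length jx < length (i # ix)"
      using len by fastforce
  next
    fix f g :: "real ^ 'n \<Rightarrow> real"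
    assume sm: "smooth f" "smooth g"
    note d = smooth_has_partial_deriv[OF smooth_iter_partial[OF sm(1)]]
      smooth_has_partial_deriv[OF smooth_iter_partial[OF sm(2)]]
    show "iter_partial (i # ix) (\<lambda>x. f x * g x) =
        (\<lambda>x. iter_partial (i # ix) f x * g x +
              (\<Sum>(jx, kx)\<leftarrow>?L. iter_partial jx f x * iter_partial kx g x))"
    proof
      fix x
      have s: "((\<lambda>t. \<Sum>(jx, kx)\<leftarrow>M. iter_partial jx f (x + t *\<^sub>R axis i 1) * iter_partial kx g (x + t *\<^sub>R axis i 1))
         has_real_derivative
           (\<Sum>(jx, kx)\<leftarrow>map (\<lambda>(jx, kx). (i # jx, kx)) M @ map (\<lambda>(jx, kx). (jx, i # kx)) M.
              iter_partial jx f x * iter_partial kx g x)) (at 0)" for M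
      proof (induction M)
        case (Cons a M)
        then show ?case
          by (cases a) (auto intro!: derivative_eq_intros d Cons simp: algebra_simps)
      qed simp
      have "iter_partial (i # ix) (\<lambda>x. f x * g x) x =
        partial_deriv i (\<lambda>x. iter_partial ix f x * g x +
              (\<Sum>(jx, kx)\<leftarrow>L. iter_partial jx f x * iter_partial kx g x)) x"
        by (simp add: eq sm)
      also have "\<dots> = iter_partial (i # ix) f x * g x +
              (\<Sum>(jx, kx)\<leftarrow>?L. iter_partial jx f x * iter_partial kx g x)"
        by (rule partial_deriv_eqI)
          (auto intro!: derivative_eq_intros d(1)[of ix] smooth_has_partial_deriv[OF sm(2)] s
             simp: algebra_simps)
      finally show "iter_partial (i # ix) (\<lambda>x. f x * g x) x = \<dots>" .
    qed
  qed
qed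

text \<open>The Leibniz formula expresses each iterated partial derivative of the product as a finite sum of
products of differentiable functions.\<close>

lemma smooth_mult:
  fixes f g :: "real ^ 'n \<Rightarrow> real"
  assumes "smooth f" "smooth g"
  shows "smooth (\<lambda>x. f x * g x)"
  unfolding smooth_def
proof (intro allI)
  fix ix x
  obtain L where L: "iter_partial ix (\<lambda>x. f x * g x) =
        (\<lambda>x. iter_partial ix f x * g x +
              (\<Sum>(jx, kx)\<leftarrow>L. iter_partial jx f x * iter_partial kx g x))"
    using Leibniz_iter_partial[of ix] assms by blast
  have "(\<lambda>x. \<Sum>(jx, kx)\<leftarrow>M. iter_partial jx f x * iter_partial kx g x) differentiable at x" for M
  proof (induction M)
    case (Cons a M)
    have "(\<lambda>x. iter_partial (fst a) f x * iter_partial (snd a) g x) differentiable at x"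
      by (intro differentiable_mult smooth_differentiable smooth_iter_partial assms)
    with Cons show ?case
      by (simp add: case_prod_unfold differentiable_add)
  qed simp
  then show "iter_partial ix (\<lambda>x. f x * g x) differentiable at x"
    unfolding L
    by (intro differentiable_add differentiable_mult)
      (auto intro!: smooth_differentiable smooth_iter_partial assms)
qed

lemma smooth_prod:
  fixes f :: "'a \<Rightarrow> real ^ 'n \<Rightarrow> real"
  assumes "finite A" "\<And>i. i \<in> A \<Longrightarrow> smooth (f i)"
  shows "smooth (\<lambda>x. \<Prod>i\<in>A. f i x)"
  using assms by (induction A rule: finite_induct) (auto simp: smooth_const smooth_mult)

lemma iter_partial_cmult:
  assumes "smooth f"
  shows "iter_partial ix (\<lambda>x. c * f x) = (\<lambda>x. c * iter_partial ix f x)"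
proof (induction ix)
  case (Cons i ix)
  show ?case
    by (auto simp: Cons intro!: partial_deriv_eqI derivative_eq_intros
          smooth_has_partial_deriv[OF smooth_iter_partial[OF assms]])
qed simp

lemma iter_partial_translate:
  "iter_partial ix (\<lambda>x. f (x - a)) = (\<lambda>x. iter_partial ix f (x - a))"
proof (induction ix)
  case (Cons i ix)
  show ?case
    unfolding iter_partial.simps Cons partial_deriv_def
    by (intro ext arg_cong2[where f = deriv]) (auto simp: algebra_simps)
qed simp

lemma smooth_translate:
  assumes "smooth f"
  shows "smooth (\<lambda>x. f (x - a))"
  unfolding smooth_def iter_partial_translate
proof (intro allI)
  fix ix x
  have "iter_partial ix f differentiable at (x - a)"
    using assms by (simp add: smooth_def)
  then show "(\<lambda>x. iter_partial ix f (x - a)) differentiable at x"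
    by (intro differentiable_compose[of "iter_partial ix f" "\<lambda>x. x - a" x UNIV]) 
       (auto intro!: differentiable_diff)
qed

section \<open>Test functions\<close>

lemma nonzero_in_support: "f x \<noteq> 0 \<Longrightarrow> x \<in> closure {x. f x \<noteq> 0}"
  by (rule closure_subset[THEN subsetD]) simp

lemma iter_partial_outside_support:
  assumes "x \<notin> closure {x. f x \<noteq> 0}"
  shows "iter_partial ix f x = 0"
  using assms
proof (induction ix arbitrary: x)
  case Nil
  then show ?case using nonzero_in_support[of f x] by auto
next
  case (Cons i ix)
  have "open (- closure {x. f x \<noteq> 0})" by auto
  moreover have "x \<in> - closure {x. f x \<noteq> 0}" using Cons.prems by simp
  ultimately obtain e where e: "e > 0" "ball x e \<subseteq> - closure {x. f x \<noteq> 0}"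
    by (rule openE)
  have "\<forall>\<^sub>F t in nhds 0. iter_partial ix f (x + t *\<^sub>R axis i 1) = 0"
    unfolding eventually_nhds_metric
  proof (intro exI[of _ e] conjI allI impI e)
    fix t :: real assume "dist t 0 < e"
    then have "x + t *\<^sub>R axis i 1 \<in> ball x e" by (simp add: dist_norm norm_axis_1)
    then show "iter_partial ix f (x + t *\<^sub>R axis i 1) = 0"
      using e Cons.IH by blast
  qed
  then have "((\<lambda>t. iter_partial ix f (x + t *\<^sub>R axis i 1)) has_real_derivative 0) (at 0)"
    by (subst DERIV_cong_ev[OF refl _ refl, of _ "\<lambda>t. 0"]) auto
  then show ?case by (simp add: partial_deriv_eqI)
qed

lemma support_iter_partial:
  "closure {x. iter_partial ix f x \<noteq> 0} \<subseteq> closure {x. f x \<noteq> 0}"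
  using iter_partial_outside_support by (intro closure_minimal) auto

lemma test_functions_mono: "\<Omega> \<subseteq> \<Omega>' \<Longrightarrow> test_functions \<Omega> \<subseteq> test_functions \<Omega>'"
  by (auto simp: test_functions_def)

lemma test_functions_smooth: "f \<in> test_functions \<Omega> \<Longrightarrow> smooth f"
  by (simp add: test_functions_def)

lemma test_functions_zero: "f \<in> test_functions \<Omega> \<Longrightarrow> x \<notin> \<Omega> \<Longrightarrow> f x = 0"
  using nonzero_in_support[of f x] by (auto simp: test_functions_def)

lemma compact_closure_mono:
  fixes A B :: "'a::heine_borel set"
  assumes "compact (closure B)" "closure A \<subseteq> closure B"
  shows "compact (closure A)"
  using assms bounded_subset by (auto simp: compact_eq_bounded_closed)

lemma test_functions_iter_partial:
  assumes "f \<in> test_functions \<Omega>"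
  shows "iter_partial ix f \<in> test_functions \<Omega>"
proof -
  have "compact (closure {x. iter_partial ix f x \<noteq> 0})"
    using assms by (intro compact_closure_mono[OF _ support_iter_partial[of ix f]])
       (auto simp: test_functions_def)
  then show ?thesis
    using assms support_iter_partial[of ix f]
    by (auto simp: test_functions_def smooth_iter_partial)
qed

lemma test_functions_mult:
  assumes "f \<in> test_functions UNIV" "g \<in> test_functions \<Omega>"
  shows "(\<lambda>x. f x * g x) \<in> test_functions \<Omega>"
proof -
  have sub: "closure {x. f x * g x \<noteq> 0} \<subseteq> closure {x. g x \<noteq> 0}"
    by (rule closure_mono) auto
  have "compact (closure {x. f x * g x \<noteq> 0})"
    using assms(2) by (intro compact_closure_mono[OF _ sub]) (auto simp: test_functions_def)
  then show ?thesis
    using assms sub by (auto simp: test_functions_def smooth_mult)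
qed

lemma test_functions_cmult:
  assumes "f \<in> test_functions \<Omega>"
  shows "(\<lambda>x. c * f x) \<in> test_functions \<Omega>"
proof (cases "c = 0")
  case True
  then show ?thesis by (simp add: test_functions_def smooth_const)
next
  case False
  then show ?thesis
    using assms smooth_mult[OF smooth_const[of c], of f] by (auto simp: test_functions_def)
qed

lemma test_functions_translate:
  assumes "f \<in> test_functions (ball 0 d)"
  shows "(\<lambda>x. f (x - a)) \<in> test_functions (ball a d)"
proof -
  have "{x. f (x - a) \<noteq> 0} = (+) a ` {x. f x \<noteq> 0}"
  proof (intro equalityI subsetI)
    fix x assume "x \<in> {x. f (x - a) \<noteq> 0}"
    then show "x \<in> (+) a ` {x. f x \<noteq> 0}" by (intro image_eqI[of _ _ "x - a"]) auto
  qed auto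
  then have cl: "closure {x. f (x - a) \<noteq> 0} = (+) a ` closure {x. f x \<noteq> 0}"
    by (simp add: closure_translation)
  have "(+) a ` closure {x. f x \<noteq> 0} \<subseteq> ball a d"
    using assms by (auto simp: test_functions_def dist_norm)
  moreover have "compact ((+) a ` closure {x. f x \<noteq> 0})"
    using assms by (intro compact_translation) (auto simp: test_functions_def)
  ultimately show ?thesis
    using assms unfolding test_functions_def mem_Collect_eq cl by (auto simp: smooth_translate)
qed

lemma test_functions_bounded:
  assumes "f \<in> test_functions \<Omega>"
  obtains B R where "B > 0" "R > 0" "\<And>x. \<bar>f x\<bar> \<le> B" "\<And>x. norm x \<ge> R \<Longrightarrow> f x = 0"
proof -
  have c: "compact (closure {x. f x \<noteq> 0})" and s: "smooth f"
    using assms by (auto simp: test_functions_def)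
  have "bounded (f ` closure {x. f x \<noteq> 0})"
    by (intro compact_imp_bounded compact_continuous_image smooth_continuous_on s c)
  then obtain B where B: "B > 0" "\<And>x. x \<in> closure {x. f x \<noteq> 0} \<Longrightarrow> \<bar>f x\<bar> \<le> B"
    by (auto simp: bounded_pos)
  have B': "\<bar>f x\<bar> \<le> B" for x
    using B nonzero_in_support[of f x] by (cases "f x = 0") auto
  obtain R where R: "R > 0" "\<And>x. x \<in> closure {x. f x \<noteq> 0} \<Longrightarrow> norm x \<le> R"
    using compact_imp_bounded[OF c] by (auto simp: bounded_pos)
  have "f x = 0" if "norm x \<ge> R + 1" for x
    using R(2)[of x] that nonzero_in_support[of f x] by (cases "f x = 0") auto
  then show ?thesis using that[of B "R + 1"] B B' R by auto
qed

section \<open>A bump function\<close>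

text \<open>The functions \<open>P(1/s) exp(-1/s)\<close>, continued by zero to \<open>s \<le> 0\<close>: a family that contains
the classical flat function \<open>exp(-1/s)\<close> (the case \<open>P = 1\<close>) and is stable under differentiation.\<close>

definition flat_exp :: "real poly \<Rightarrow> real \<Rightarrow> real" where
  "flat_exp P s = (if s > 0 then poly P (1 / s) * exp (- 1 / s) else 0)"

lemma poly_div_exp_tendsto_0: "((\<lambda>u. poly P u / exp u) \<longlongrightarrow> (0::real)) at_top"
proof -
  have "((\<lambda>u. \<Sum>i\<le>degree P. coeff P i * (u ^ i / exp u)) \<longlongrightarrow> (\<Sum>i\<le>degree P. coeff P i * 0)) at_top"
    by (intro tendsto_sum tendsto_mult tendsto_const tendsto_power_div_exp_0)
  then show ?thesis by (simp add: poly_altdef sum_divide_distrib)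
qed

text \<open>With \<open>u = 1/s\<close>, differentiating \<open>P(u) exp(-u)\<close> gives \<open>u\<^sup>2 (P(u) - P'(u)) exp(-u)\<close>; at the origin
exponential decay in \<open>u\<close> beats every polynomial.\<close>

lemma flat_exp_has_derivative:
  "(flat_exp P has_real_derivative flat_exp ([:0, 0, 1:] * (P - pderiv P)) s) (at s)"
proof -
  consider "s > 0" | "s < 0" | "s = 0" by linarith
  then show ?thesis
  proof cases
    case 1
    have "\<forall>\<^sub>F t in nhds s. flat_exp P t = poly P (1 / t) * exp (- 1 / t)"
      using eventually_nhds_in_open[of "{0<..}" s] 1
      by (auto elim!: eventually_mono simp: flat_exp_def)
    moreover have "((\<lambda>t. poly P (1 / t) * exp (- 1 / t)) has_real_derivative
        flat_exp ([:0, 0, 1:] * (P - pderiv P)) s) (at s)"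
      using 1
      by (auto intro!: derivative_eq_intros DERIV_chain2[OF poly_DERIV]
          simp: flat_exp_def field_simps power2_eq_square)
    ultimately show ?thesis
      by (subst DERIV_cong_ev[OF refl _ refl]) auto
  next
    case 2
    have "\<forall>\<^sub>F t in nhds s. flat_exp P t = 0"
      using eventually_nhds_in_open[of "{..<0}" s] 2
      by (auto elim!: eventually_mono simp: flat_exp_def)
    then show ?thesis
      using 2 by (subst DERIV_cong_ev[OF refl _ refl, of _ "\<lambda>_. 0"]) (auto simp: flat_exp_def)
  next
    case 3
    have "((\<lambda>t. poly (pCons 0 P) (inverse t) / exp (inverse t)) \<longlongrightarrow> 0) (at_right 0)"
      by (rule filterlim_compose[OF poly_div_exp_tendsto_0 filterlim_inverse_at_top_right])
    moreover have "\<forall>\<^sub>F t in at_right 0.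
        poly (pCons 0 P) (inverse t) / exp (inverse t) = (flat_exp P t - flat_exp P 0) / (t - 0)"
      by (auto simp: flat_exp_def eventually_at_filter exp_minus field_simps)
    ultimately have "((\<lambda>t. (flat_exp P t - flat_exp P 0) / (t - 0)) \<longlongrightarrow> 0) (at_right 0)"
      by (simp add: tendsto_cong)
    moreover have "((\<lambda>t. (flat_exp P t - flat_exp P 0) / (t - 0)) \<longlongrightarrow> 0) (at_left 0)"
      by (rule tendsto_eventually) (auto simp: flat_exp_def eventually_at_filter)
    ultimately have "((\<lambda>t. (flat_exp P t - flat_exp P 0) / (t - 0)) \<longlongrightarrow> 0) (at 0)"
      by (simp add: filterlim_split_at)
    then show ?thesis
      unfolding 3 has_field_derivative_iff by (simp add: flat_exp_def)
  qed
qed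

lemma smooth_flat_exp_coordinate:
  "smooth (\<lambda>x :: real ^ 'n. flat_exp P (c + \<sigma> * x $ i))"
proof (rule smooth_coinduct[where S = "{g. \<exists>a P. g = (\<lambda>x. a * flat_exp P (c + \<sigma> * x $ i))}"])
  show "(\<lambda>x :: real ^ 'n. flat_exp P (c + \<sigma> * x $ i))
      \<in> {g. \<exists>a P. g = (\<lambda>x. a * flat_exp P (c + \<sigma> * x $ i))}"
    by (intro CollectI exI[of _ 1] exI[of _ P]) simp
next
  fix g :: "real ^ 'n \<Rightarrow> real" and x :: "real ^ 'n"
  assume "g \<in> {g. \<exists>a P. g = (\<lambda>x. a * flat_exp P (c + \<sigma> * x $ i))}"
  then obtain a P where g: "g = (\<lambda>x. a * flat_exp P (c + \<sigma> * x $ i))" by blast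
  have "flat_exp P differentiable at (c + \<sigma> * x $ i)"
    using flat_exp_has_derivative real_differentiable_def by blast
  moreover have "(\<lambda>x :: real ^ 'n. c + \<sigma> * x $ i) differentiable at x"
    by (intro differentiable_add differentiable_mult differentiable_const
        bounded_linear_imp_differentiable[OF bounded_linear_vec_nth])
  ultimately have "(\<lambda>x. flat_exp P (c + \<sigma> * x $ i)) differentiable at x"
    using differentiable_compose[of "flat_exp P" "\<lambda>x. c + \<sigma> * x $ i" x UNIV] by simp
  then show "g differentiable at x" unfolding g by simp
next
  fix g :: "real ^ 'n \<Rightarrow> real" and j
  assume "g \<in> {g. \<exists>a P. g = (\<lambda>x. a * flat_exp P (c + \<sigma> * x $ i))}"
  then obtain a P where g: "g = (\<lambda>x. a * flat_exp P (c + \<sigma> * x $ i))" by blast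
  have "partial_deriv j g x = (a * \<sigma> * axis j 1 $ i) *
      flat_exp ([:0, 0, 1:] * (P - pderiv P)) (c + \<sigma> * x $ i)" for x
    unfolding g
    by (rule partial_deriv_eqI)
      (auto intro!: derivative_eq_intros DERIV_chain2[OF flat_exp_has_derivative])
  then show "partial_deriv j g \<in> {g. \<exists>a P. g = (\<lambda>x. a * flat_exp P (c + \<sigma> * x $ i))}"
    by blast
qed

text \<open>A product of flat functions of \<open>a + x\<^sub>i\<close> and \<open>a - x\<^sub>i\<close> is supported in the cube \<open>|x\<^sub>i| \<le> a\<close>, which
lies in the ball of radius \<open>n a\<close>.\<close>

lemma exists_bump_function:
  assumes "d > 0"
  shows "\<exists>\<psi> \<in> test_functions (ball (0 :: real ^ 'n) d). \<psi> 0 \<noteq> 0"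
proof -
  define a where "a = d / (2 * CARD('n))"
  have a: "a > 0" using assms by (simp add: a_def)
  define \<psi> :: "real ^ 'n \<Rightarrow> real" where
    "\<psi> x = (\<Prod>i\<in>UNIV. flat_exp 1 (a + 1 * x $ i) * flat_exp 1 (a + (- 1) * x $ i))" for x
  have smooth: "smooth \<psi>"
    unfolding \<psi>_def by (intro smooth_prod smooth_mult smooth_flat_exp_coordinate) auto
  have "{x. \<psi> x \<noteq> 0} \<subseteq> cball 0 (d / 2)"
  proof safe
    fix x :: "real ^ 'n" assume "\<psi> x \<noteq> 0"
    then have "\<bar>x $ i\<bar> \<le> a" for i
      by (auto simp: \<psi>_def flat_exp_def split: if_splits) (smt (verit))
    then have "(\<Sum>i\<in>UNIV. \<bar>x $ i\<bar>) \<le> CARD('n) * a"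
      using sum_bounded_above[of UNIV "\<lambda>i. \<bar>x $ i\<bar>" a] by simp
    then have "norm x \<le> CARD('n) * a"
      using norm_le_l1_cart[of x] by linarith
    then show "x \<in> cball 0 (d / 2)" by (simp add: a_def)
  qed
  then have "closure {x. \<psi> x \<noteq> 0} \<subseteq> cball 0 (d / 2)"
    by (rule closure_minimal) simp
  moreover have "compact (closure {x. \<psi> x \<noteq> 0})"
    using calculation by (meson bounded_cball bounded_subset closed_closure compact_eq_bounded_closed)
  moreover have "cball 0 (d / 2) \<subseteq> ball (0 :: real ^ 'n) d" using assms by auto
  ultimately have "\<psi> \<in> test_functions (ball 0 d)"
    using smooth by (auto simp: test_functions_def)
  moreover have "\<psi> 0 \<noteq> 0" using a by (auto simp: \<psi>_def flat_exp_def)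
  ultimately show ?thesis by blast
qed

section \<open>Inequalities for powers and integrals\<close>

lemma powr_sum_le:
  fixes a :: "'a \<Rightarrow> real"
  assumes "finite I" "\<And>i. i \<in> I \<Longrightarrow> 0 \<le> a i" "0 \<le> p"
  shows "(\<Sum>i\<in>I. a i) powr p \<le> real (card I) powr p * (\<Sum>i\<in>I. a i powr p)"
proof (cases "I = {}")
  case False
  define b where "b = Max (a ` I)"
  have "b \<in> a ` I"
    unfolding b_def using assms(1) False by (intro Max_in) auto
  then obtain j where j: "j \<in> I" "a j = b" by blast
  have "a i \<le> b" if "i \<in> I" for i
    using assms(1) that by (simp add: b_def)
  then have "(\<Sum>i\<in>I. a i) \<le> card I * b"
    using sum_bounded_above[of I a b] by simp
  then have "(\<Sum>i\<in>I. a i) powr p \<le> (card I * b) powr p"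
    by (intro powr_mono2 assms sum_nonneg)
  also have "\<dots> = card I powr p * b powr p"
    using assms(2)[OF j(1)] j by (simp add: powr_mult)
  also have "b powr p \<le> (\<Sum>i\<in>I. a i powr p)"
    using member_le_sum[of j I "\<lambda>i. a i powr p"] j assms(1) by simp
  finally show ?thesis by (simp add: mult_left_mono)
qed simp

text \<open>Convexity of \<open>t \<mapsto> t\<^sup>p\<close>, in the form of the tangent at \<open>a\<close>; after the substitution \<open>t = a u\<close> it is
Young's inequality between \<open>u\<^sup>p\<close> and \<open>1\<close>.\<close>

lemma powr_above_tangent:
  fixes a t :: real
  assumes "1 \<le> p" "0 < a" "0 \<le> t"
  shows "a powr p + p * a powr (p - 1) * (t - a) \<le> t powr p"
proof (cases "t = 0")
  case True
  have "a powr p = a powr (p - 1) * a"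
    using assms by (simp add: powr_diff)
  then have "a powr p + p * a powr (p - 1) * (t - a) = (1 - p) * a powr p"
    using True by (simp add: algebra_simps)
  also have "\<dots> \<le> 0" using assms by (intro mult_nonpos_nonneg) auto
  finally show ?thesis using True by simp
next
  case False
  define u where "u = t / a"
  have u: "u > 0" "t = a * u" using assms False by (auto simp: u_def)
  have "u = (u powr p) powr (1 / p) * 1 powr (1 - 1 / p)"
    using u assms by (simp add: powr_powr)
  also have "\<dots> \<le> (1 / p) * u powr p + (1 - 1 / p) * 1"
    using u assms by (intro Youngs_inequality_0) (auto simp: field_simps)
  finally have "p * u \<le> p * ((1 / p) * u powr p + (1 - 1 / p) * 1)"
    using assms by (intro mult_left_mono) auto
  also have "\<dots> = u powr p + p - 1" using assms by (simp add: field_simps)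
  finally have "1 + p * (u - 1) \<le> u powr p" by (simp add: algebra_simps)
  then have "a powr p * (1 + p * (u - 1)) \<le> a powr p * u powr p"
    by (intro mult_left_mono) auto
  also have "\<dots> = t powr p" using u assms by (simp add: powr_mult)
  finally have "a powr p * (1 + p * (u - 1)) \<le> t powr p" .
  moreover have "a powr p = a powr (p - 1) * a" using assms by (simp add: powr_diff)
  then have "a powr p * (1 + p * (u - 1)) = a powr p + p * a powr (p - 1) * (t - a)"
    by (simp add: u algebra_simps)
  ultimately show ?thesis by simp
qed

text \<open>The fundamental theorem of calculus combined with Jensen's inequality on the unit interval.  Jensen's
inequality is obtained by integrating the tangent inequality at the mean value \<open>a\<close>, where the linear
term \<open>\<sigma> f - a\<close> integrates to zero.\<close>

lemma increment_powr_le_nn_integral: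
  fixes F f :: "real \<Rightarrow> real"
  assumes p: "1 \<le> p" and F: "\<And>s. (F has_real_derivative f s) (at s)"
    and cont: "continuous_on {0..1} f"
  shows "ennreal (\<bar>F 1 - F 0\<bar> powr p) \<le> (\<integral>\<^sup>+s\<in>{0..1}. ennreal (\<bar>f s\<bar> powr p) \<partial>lborel)"
proof (cases "F 1 = F 0")
  case False
  define a where "a = \<bar>F 1 - F 0\<bar>"
  define \<sigma> where "\<sigma> = sgn (F 1 - F 0)"
  define g where "g s = a powr p + p * a powr (p - 1) * (\<sigma> * f s - a)" for s
  define G where "G s = a powr p * s + p * a powr (p - 1) * (\<sigma> * F s - a * s)" for s
  have a: "a > 0" "\<sigma> * (F 1 - F 0) = a" "\<bar>\<sigma>\<bar> = 1"
    using False by (auto simp: a_def \<sigma>_def sgn_if)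
  have "(g has_integral (G 1 - G 0)) {0..1}"
  proof (rule fundamental_theorem_of_calculus)
    fix s
    have "(G has_real_derivative g s) (at s)"
      unfolding G_def g_def by (auto intro!: derivative_eq_intros F)
    then show "(G has_vector_derivative g s) (at s within {0..1})"
      by (metis has_real_derivative_iff_has_vector_derivative has_vector_derivative_at_within)
  qed simp
  moreover have "G 1 - G 0 = a powr p"
    using a by (simp add: G_def algebra_simps)
  ultimately have g: "(g has_integral a powr p) {0..1}" by simp
  have "continuous_on {0..1} (\<lambda>s. \<bar>f s\<bar> powr p)"
    using p by (intro continuous_on_powr' continuous_intros cont) auto
  then obtain I where I: "((\<lambda>s. \<bar>f s\<bar> powr p) has_integral I) {0..1}"
    by (metis integrable_continuous_real has_integral_integrable_integral)
  have "a powr p \<le> I"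
  proof (rule has_integral_le[OF g I])
    fix s
    have "\<sigma> * f s \<le> \<bar>f s\<bar>"
      using a(3) by (metis abs_ge_self abs_mult mult_1)
    then have "g s \<le> a powr p + p * a powr (p - 1) * (\<bar>f s\<bar> - a)"
      unfolding g_def using p by (intro add_left_mono mult_left_mono) auto
    also have "\<dots> \<le> \<bar>f s\<bar> powr p" by (rule powr_above_tangent[OF p a(1)]) simp
    finally show "g s \<le> \<bar>f s\<bar> powr p" .
  qed
  also have "ennreal I = (\<integral>\<^sup>+s. indicator {0..1} s * \<bar>f s\<bar> powr p \<partial>lborel)"
    by (rule nn_integral_has_integral_lebesgue[symmetric, OF _ I]) simp
  also have "\<dots> = (\<integral>\<^sup>+s\<in>{0..1}. ennreal (\<bar>f s\<bar> powr p) \<partial>lborel)"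
    by (intro nn_integral_cong) (auto simp: indicator_def)
  finally show ?thesis by (simp add: a_def ennreal_leI)
qed simp

lemma nn_integral_lborel_affine:
  fixes f :: "'a::euclidean_space \<Rightarrow> ennreal"
  assumes [measurable]: "f \<in> borel_measurable borel" and "c \<noteq> 0"
  shows "ennreal (\<bar>c\<bar> ^ DIM('a)) * (\<integral>\<^sup>+x. f (t + c *\<^sub>R x) \<partial>lborel) = (\<integral>\<^sup>+x. f x \<partial>lborel)"
proof -
  have "(\<integral>\<^sup>+x. f x \<partial>lborel) =
      (\<integral>\<^sup>+x. f x \<partial>density (distr lborel borel (\<lambda>x. t + c *\<^sub>R x)) (\<lambda>_. ennreal (\<bar>c\<bar> ^ DIM('a))))"
    using lborel_affine[OF assms(2), of t] by simp
  also have "\<dots> = ennreal (\<bar>c\<bar> ^ DIM('a)) * (\<integral>\<^sup>+x. f (t + c *\<^sub>R x) \<partial>lborel)"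
    by (simp add: nn_integral_density nn_integral_distr nn_integral_cmult)
  finally show ?thesis ..
qed

lemma ennreal_cmult_le_imp_le:
  assumes "ennreal c * I \<le> Z" "c > 0"
  shows "I \<le> ennreal (1 / c) * Z"
proof -
  have "I = ennreal (1 / c) * (ennreal c * I)"
    using assms(2) by (simp add: mult.assoc[symmetric] ennreal_mult[symmetric])
  also have "\<dots> \<le> ennreal (1 / c) * Z"
    by (intro mult_left_mono assms) auto
  finally show ?thesis .
qed

lemma ennreal_cmult_le_imp:
  assumes "ennreal c * I \<le> ennreal A" "c > 0"
  shows "I \<le> ennreal (A / c)"
  using ennreal_cmult_le_imp_le[OF assms] assms(2) by (simp add: ennreal_mult'[symmetric])

section \<open>The Muckenhoupt property of the power weight\<close>

lemma power_weight_nonneg: "0 \<le> power_weight \<theta> x"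
  by (simp add: power_weight_def)

lemma power_weight_borel [measurable]: "power_weight \<theta> \<in> borel_measurable borel"
  unfolding power_weight_def by measurable

text \<open>On the dyadic shell \<open>R / 2\<^sup>k\<^sup>+\<^sup>1 \<le> |z| < R / 2\<^sup>k\<close> the weight is at most its value on the inner sphere,
and the shells contribute a geometric series of ratio \<open>q = 2 powr - (n + \<theta>) < 1\<close>.\<close>

lemma power_weight_integral_ball:
  assumes "- real CARD('n) < \<theta>" "\<theta> \<le> 0"
  shows "\<exists>C>0. \<forall>R>0. (\<integral>\<^sup>+z\<in>ball (0 :: real ^ 'n) R. ennreal (power_weight \<theta> z) \<partial>lborel)
           \<le> ennreal (C * R powr (real CARD('n) + \<theta>))"
proof -
  define n where "n = CARD('n)"
  define v where "v = unit_ball_vol (real n)"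
  define q where "q = (1 / 2) powr (real n + \<theta>)"
  define C where "C = v * 2 powr (- \<theta>) * (1 / (1 - q))"
  have v: "v > 0" by (simp add: v_def)
  have "(real n + \<theta>) * ln (1 / 2) < 0"
    using assms by (intro mult_pos_neg) (auto simp: n_def)
  then have q: "0 < q" "q < 1"
    by (auto simp: q_def powr_def)
  have "C > 0" using v q by (simp add: C_def)
  moreover have "(\<integral>\<^sup>+z\<in>ball (0 :: real ^ 'n) R. ennreal (power_weight \<theta> z) \<partial>lborel)
           \<le> ennreal (C * R powr (real n + \<theta>))" if R: "R > 0" for R
  proof -
    define r where "r k = R * (1 / 2) ^ k" for k :: nat
    have r: "r k > 0" for k using R by (simp add: r_def)
    define f where "f k z = ennreal (r (Suc k) powr \<theta>) * indicator (ball 0 (r k)) z"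
      for k and z :: "real ^ 'n"
    have le: "ennreal (power_weight \<theta> z) * indicator (ball 0 R) z \<le> (\<Sum>k. f k z)" for z :: "real ^ 'n"
    proof (cases "z = 0 \<or> norm z \<ge> R")
      case True
      then show ?thesis by (auto simp: power_weight_def)
    next
      case False
      define P where "P k \<longleftrightarrow> r (Suc k) \<le> norm z" for k
      obtain k0 where "(1 / 2) ^ k0 < norm z / R"
        using real_arch_pow_inv[of "norm z / R" "1 / 2"] False R by auto
      then have "r k0 < norm z" using R by (simp add: r_def field_simps)
      moreover have "r (Suc k0) \<le> r k0" using R by (simp add: r_def)
      ultimately have "\<exists>k. P k" by (auto simp: P_def intro!: exI[of _ k0])
      \<comment> \<open>The least such index is that of the shell containing \<open>z\<close>.\<close>
      define k where "k = (LEAST k. P k)"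
      have k: "r (Suc k) \<le> norm z"
        using LeastI_ex[OF \<open>\<exists>k. P k\<close>] by (simp add: k_def P_def)
      have "norm z < r k"
      proof (cases k)
        case 0
        then show ?thesis using False by (simp add: r_def)
      next
        case (Suc j)
        then have "\<not> P j" using not_less_Least[of j P] by (simp add: k_def)
        then show ?thesis using Suc by (simp add: P_def)
      qed
      then have "ennreal (power_weight \<theta> z) * indicator (ball 0 R) z \<le> f k z"
        using k r[of "Suc k"] assms(2) False
        by (auto simp: f_def power_weight_def intro!: ennreal_leI powr_mono2')
      also have "\<dots> \<le> (\<Sum>k. f k z)"
        using sum_le_suminf[of "\<lambda>k. f k z" "{k}"] by simp
      finally show ?thesis .
    qed
    have integral_f: "(\<integral>\<^sup>+z. f k z \<partial>lborel) = ennreal (v * 2 powr (- \<theta>) * R powr (real n + \<theta>) * q ^ k)" for k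
    proof -
      have "(\<integral>\<^sup>+z. f k z \<partial>lborel) = ennreal (r (Suc k) powr \<theta>) * ennreal (v * r k ^ n)"
        using r[of k] by (simp add: f_def nn_integral_cmult_indicator emeasure_ball v_def n_def)
      also have "\<dots> = ennreal (r (Suc k) powr \<theta> * (v * r k ^ n))"
        using v r[of k] by (intro ennreal_mult[symmetric]) auto
      also have "r (Suc k) powr \<theta> * (v * r k ^ n) = v * 2 powr (- \<theta>) * R powr (real n + \<theta>) * q ^ k"
      proof -
        have "r (Suc k) powr \<theta> = r k powr \<theta> * 2 powr (- \<theta>)"
          using r[of k] by (simp add: r_def powr_mult powr_divide powr_minus divide_simps)
        moreover have "r k ^ n = r k powr real n" using r[of k] by (simp add: powr_realpow)
        moreover have "r k powr \<theta> * r k powr real n = R powr (real n + \<theta>) * q ^ k"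
        proof -
          have "r k powr \<theta> * r k powr real n = r k powr (real n + \<theta>)"
            by (simp add: powr_add mult.commute)
          also have "\<dots> = R powr (real n + \<theta>) * ((1 / 2) powr real k) powr (real n + \<theta>)"
            using R by (simp add: r_def powr_mult powr_realpow)
          also have "((1 / 2) powr real k) powr (real n + \<theta>) = q ^ k"
            unfolding q_def using powr_realpow[of "(1/2) powr (real n + \<theta>)" k]
            by (simp add: powr_powr mult.commute)
          finally show ?thesis .
        qed
        moreover have "(r k powr \<theta> * 2 powr (- \<theta>)) * (v * r k powr real n)
            = v * 2 powr (- \<theta>) * (r k powr \<theta> * r k powr real n)"
          by simp
        ultimately show ?thesis by (simp only: mult.assoc)
      qed
      finally show ?thesis .
    qed
    have "(\<integral>\<^sup>+z\<in>ball (0 :: real ^ 'n) R. ennreal (power_weight \<theta> z) \<partial>lborel)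
        \<le> (\<integral>\<^sup>+z. (\<Sum>k. f k z) \<partial>lborel)"
      by (intro nn_integral_mono le)
    also have "\<dots> = (\<Sum>k. \<integral>\<^sup>+z. f k z \<partial>lborel)"
    proof (rule nn_integral_suminf)
      fix k
      show "f k \<in> borel_measurable lborel"
        unfolding f_def[abs_def]
        by (intro borel_measurable_times_ennreal borel_measurable_const borel_measurable_indicator) auto
    qed
    also have "\<dots> = (\<Sum>k. ennreal (v * 2 powr (- \<theta>) * R powr (real n + \<theta>) * q ^ k))"
      by (simp only: integral_f)
    also have "\<dots> = ennreal (v * 2 powr (- \<theta>) * R powr (real n + \<theta>) * (1 / (1 - q)))"
      using v q by (intro suminf_ennreal_eq sums_mult geometric_sums) auto
    finally show ?thesis by (simp add: C_def mult_ac)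
  qed
  ultimately show ?thesis unfolding n_def by blast
qed

text \<open>The condition \<open>A\<^sub>1\<close> for balls of radius \<open>s r\<close>.  Far from the origin, \<open>|y| \<ge> 2 s r\<close>, the weight is
comparable to \<open>w(y)\<close> on the whole ball.  Otherwise the ball lies in the ball of radius \<open>3 s r\<close>
around the origin, where the mean of \<open>w\<close> is of the order \<open>(s r)\<^sup>\<theta>\<close>, and this is at most a multiple of
\<open>|y|\<^sup>\<theta>\<close> because \<open>|y| < 2 s r\<close> and \<open>\<theta> \<le> 0\<close>.\<close>

lemma power_weight_average:
  assumes "- real CARD('n) < \<theta>" "\<theta> \<le> 0"
  shows "\<exists>C>0. \<forall>r>0. \<forall>s\<in>{0..1}. \<forall>y. y \<noteq> 0 \<longrightarrow>
           (\<integral>\<^sup>+h\<in>ball (0 :: real ^ 'n) r. ennreal (power_weight \<theta> (y - s *\<^sub>R h)) \<partial>lborel)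
             \<le> ennreal (C * r ^ CARD('n) * power_weight \<theta> y)"
proof -
  define n where "n = CARD('n)"
  define v where "v = unit_ball_vol (real n)"
  have v: "v > 0" by (simp add: v_def)
  obtain C0 where C0: "C0 > 0" "\<And>R. R > 0 \<Longrightarrow>
      (\<integral>\<^sup>+z\<in>ball (0 :: real ^ 'n) R. ennreal (power_weight \<theta> z) \<partial>lborel)
           \<le> ennreal (C0 * R powr (real n + \<theta>))"
    using power_weight_integral_ball[OF assms] unfolding n_def by blast
  define C where "C = 2 powr (- \<theta>) * v + C0 * 3 powr (real n + \<theta>) * 2 powr (- \<theta>)"
  have C_ge: "2 powr (- \<theta>) * v \<le> C" "C0 * 3 powr (real n + \<theta>) * 2 powr (- \<theta>) \<le> C"
    using v C0 by (auto simp: C_def)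
  have "C > 0" using v C0 by (auto simp: C_def intro!: add_pos_pos)
  moreover have "(\<integral>\<^sup>+h\<in>ball (0 :: real ^ 'n) r. ennreal (power_weight \<theta> (y - s *\<^sub>R h)) \<partial>lborel)
             \<le> ennreal (C * r ^ n * power_weight \<theta> y)"
    if r: "r > 0" and s: "0 \<le> s" "s \<le> 1" and y: "y \<noteq> 0" for r s and y :: "real ^ 'n"
  proof (cases "2 * s * r \<le> norm y")
    case True
    have "power_weight \<theta> (y - s *\<^sub>R h) \<le> 2 powr (- \<theta>) * power_weight \<theta> y" if "norm h < r" for h
    proof -
      have "norm (s *\<^sub>R h) \<le> s * r" using that s by (simp add: mult_left_mono)
      then have "norm y / 2 \<le> norm (y - s *\<^sub>R h)"
        using norm_triangle_ineq2[of y "s *\<^sub>R h"] True by linarith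
      then have "norm (y - s *\<^sub>R h) powr \<theta> \<le> (norm y / 2) powr \<theta>"
        using assms(2) y by (intro powr_mono2') auto
      then show ?thesis
        by (simp add: power_weight_def powr_divide powr_minus divide_simps mult.commute)
    qed
    note pointwise = this
    have "(\<integral>\<^sup>+h\<in>ball (0 :: real ^ 'n) r. ennreal (power_weight \<theta> (y - s *\<^sub>R h)) \<partial>lborel)
        \<le> (\<integral>\<^sup>+h. ennreal (2 powr (- \<theta>) * power_weight \<theta> y) * indicator (ball (0 :: real ^ 'n) r) h \<partial>lborel)"
      by (intro nn_integral_mono) (auto simp: indicator_def intro!: ennreal_leI pointwise)
    also have "\<dots> = ennreal (2 powr (- \<theta>) * power_weight \<theta> y) * ennreal (v * r ^ n)"
      using r by (simp add: nn_integral_cmult_indicator emeasure_ball v_def n_def)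
    also have "\<dots> = ennreal (2 powr (- \<theta>) * v * (r ^ n * power_weight \<theta> y))"
      using v r by (simp add: ennreal_mult[symmetric] power_weight_nonneg mult_ac)
    also have "\<dots> \<le> ennreal (C * (r ^ n * power_weight \<theta> y))"
      using r C_ge by (intro ennreal_leI mult_right_mono) (auto simp: power_weight_nonneg)
    finally show ?thesis by (simp add: mult.assoc)
  next
    case False
    then have s0: "s > 0" using s y by (cases "s = 0") auto
    have sr: "s * r > 0" using s0 r by simp
    let ?f = "\<lambda>z :: real ^ 'n. ennreal (power_weight \<theta> z) * indicator (ball 0 (3 * (s * r))) z"
    have "(\<integral>\<^sup>+h\<in>ball (0 :: real ^ 'n) r. ennreal (power_weight \<theta> (y - s *\<^sub>R h)) \<partial>lborel)
       \<le> (\<integral>\<^sup>+h. ?f (y + (- s) *\<^sub>R h) \<partial>lborel)"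
    proof (intro nn_integral_mono)
      fix h :: "real ^ 'n"
      have "norm (y - s *\<^sub>R h) < 3 * (s * r)" if "norm h < r"
      proof -
        have "norm (s *\<^sub>R h) \<le> s * r" using that s by (simp add: mult_left_mono)
        then show ?thesis using norm_triangle_ineq4[of y "s *\<^sub>R h"] False by linarith
      qed
      then show "ennreal (power_weight \<theta> (y - s *\<^sub>R h)) * indicator (ball 0 r) h \<le> ?f (y + (- s) *\<^sub>R h)"
        by (auto simp: indicator_def)
    qed
    moreover have "?f \<in> borel_measurable borel"
      by (intro borel_measurable_times_ennreal measurable_compose[OF power_weight_borel]
          borel_measurable_indicator) auto
    then have "ennreal (s ^ n) * (\<integral>\<^sup>+h. ?f (y + (- s) *\<^sub>R h) \<partial>lborel) = (\<integral>\<^sup>+z. ?f z \<partial>lborel)"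
      using nn_integral_lborel_affine[of ?f "- s" y] s0 by (simp add: n_def)
    moreover have "(\<integral>\<^sup>+z. ?f z \<partial>lborel) \<le> ennreal (C0 * (3 * (s * r)) powr (real n + \<theta>))"
      using C0(2)[of "3 * (s * r)"] sr by simp
    ultimately have "(\<integral>\<^sup>+h\<in>ball (0 :: real ^ 'n) r. ennreal (power_weight \<theta> (y - s *\<^sub>R h)) \<partial>lborel)
       \<le> ennreal (C0 * (3 * (s * r)) powr (real n + \<theta>) / s ^ n)"
      using s0 by (metis (no_types, lifting) ennreal_cmult_le_imp order_trans zero_less_power)
    also have "C0 * (3 * (s * r)) powr (real n + \<theta>) / s ^ n
        = C0 * 3 powr (real n + \<theta>) * r ^ n * (s * r) powr \<theta>"
    proof -
      have "(3 * u) powr (real n + \<theta>) = 3 powr (real n + \<theta>) * (u ^ n * u powr \<theta>)"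
        if "u > 0" for u
        using that by (simp add: powr_mult powr_add powr_realpow)
      from this[OF sr] show ?thesis using s0 by (simp add: power_mult_distrib)
    qed
    also have "ennreal \<dots> \<le> ennreal (C0 * 3 powr (real n + \<theta>) * r ^ n * (2 powr (- \<theta>) * norm y powr \<theta>))"
    proof (intro ennreal_leI mult_left_mono)
      have "(s * r) powr \<theta> \<le> (norm y / 2) powr \<theta>"
        using False assms(2) y by (intro powr_mono2') auto
      then show "(s * r) powr \<theta> \<le> 2 powr (- \<theta>) * norm y powr \<theta>"
        by (simp add: powr_divide powr_minus divide_simps mult.commute)
    qed (use C0 r in auto)
    also have "\<dots> = ennreal (C0 * 3 powr (real n + \<theta>) * 2 powr (- \<theta>) * (r ^ n * power_weight \<theta> y))"
      by (simp add: power_weight_def mult_ac)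
    also have "\<dots> \<le> ennreal (C * (r ^ n * power_weight \<theta> y))"
      using r C_ge by (intro ennreal_leI mult_right_mono) (auto simp: power_weight_nonneg)
    finally show ?thesis by (simp add: mult.assoc)
  qed
  ultimately show ?thesis unfolding n_def
    by (intro exI[of _ C] conjI allI impI ballI) simp_all
qed

text \<open>The adjoint form of the previous lemma: the translation by \<open>s h\<close> is moved from \<open>g\<close> to the weight.\<close>

lemma weighted_ball_average:
  assumes "- real CARD('n) < \<theta>" "\<theta> \<le> 0"
  shows "\<exists>C>0. \<forall>r>0. \<forall>s\<in>{0..1}. \<forall>g\<in>borel_measurable borel.
           (\<integral>\<^sup>+x. (\<integral>\<^sup>+h\<in>ball (0 :: real ^ 'n) r. g (x + s *\<^sub>R h) \<partial>lborel) * ennreal (power_weight \<theta> x) \<partial>lborel)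
             \<le> ennreal (C * r ^ CARD('n)) * (\<integral>\<^sup>+x. g x * ennreal (power_weight \<theta> x) \<partial>lborel)"
proof -
  let ?w = "\<lambda>x :: real ^ 'n. ennreal (power_weight \<theta> x)"
  obtain C where C: "C > 0" "\<And>r s y. r > 0 \<Longrightarrow> s \<in> {0..1} \<Longrightarrow> y \<noteq> 0 \<Longrightarrow>
           (\<integral>\<^sup>+h\<in>ball (0 :: real ^ 'n) r. ?w (y - s *\<^sub>R h) \<partial>lborel)
             \<le> ennreal (C * r ^ CARD('n) * power_weight \<theta> y)"
    using power_weight_average[OF assms] by blast
  have "(\<integral>\<^sup>+x. (\<integral>\<^sup>+h\<in>ball 0 r. g (x + s *\<^sub>R h) \<partial>lborel) * ?w x \<partial>lborel)
             \<le> ennreal (C * r ^ CARD('n)) * (\<integral>\<^sup>+x. g x * ?w x \<partial>lborel)"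
    if r: "r > 0" and s: "s \<in> {0..1}" and [measurable]: "g \<in> borel_measurable borel"
    for r s and g :: "real ^ 'n \<Rightarrow> ennreal"
  proof -
    have [measurable]: "ball (0 :: real ^ 'n) r \<in> sets borel" by simp
    have "(\<integral>\<^sup>+x. (\<integral>\<^sup>+h\<in>ball 0 r. g (x + s *\<^sub>R h) \<partial>lborel) * ?w x \<partial>lborel)
        = (\<integral>\<^sup>+x. (\<integral>\<^sup>+h. g (x + s *\<^sub>R h) * ?w x * indicator (ball 0 r) h \<partial>lborel) \<partial>lborel)"
    proof (rule nn_integral_cong)
      fix x :: "real ^ 'n"
      have "(\<lambda>h. g (x + s *\<^sub>R h) * indicator (ball 0 r) h) \<in> borel_measurable lborel"
        by measurable
      from nn_integral_multc[OF this, of "?w x"]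
      show "(\<integral>\<^sup>+h\<in>ball 0 r. g (x + s *\<^sub>R h) \<partial>lborel) * ?w x
          = (\<integral>\<^sup>+h. g (x + s *\<^sub>R h) * ?w x * indicator (ball 0 r) h \<partial>lborel)"
        by (simp add: mult_ac)
    qed
    also have "\<dots> = (\<integral>\<^sup>+h. (\<integral>\<^sup>+x. g (x + s *\<^sub>R h) * ?w x * indicator (ball 0 r) h \<partial>lborel) \<partial>lborel)"
      by (rule lborel_pair.Fubini') measurable
    also have "\<dots> = (\<integral>\<^sup>+h. (\<integral>\<^sup>+y. g y * ?w (y - s *\<^sub>R h) * indicator (ball 0 r) h \<partial>lborel) \<partial>lborel)"
    proof (rule nn_integral_cong)
      fix h :: "real ^ 'n"
      show "(\<integral>\<^sup>+x. g (x + s *\<^sub>R h) * ?w x * indicator (ball 0 r) h \<partial>lborel) =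
          (\<integral>\<^sup>+y. g y * ?w (y - s *\<^sub>R h) * indicator (ball 0 r) h \<partial>lborel)"
        using nn_integral_lborel_affine[of "\<lambda>y. g y * ?w (y - s *\<^sub>R h) * indicator (ball 0 r) h" 1 "s *\<^sub>R h"]
        by (simp add: add.commute)
    qed
    also have "\<dots> = (\<integral>\<^sup>+y. (\<integral>\<^sup>+h. g y * ?w (y - s *\<^sub>R h) * indicator (ball 0 r) h \<partial>lborel) \<partial>lborel)"
      by (rule lborel_pair.Fubini') measurable
    also have "\<dots> = (\<integral>\<^sup>+y. g y * (\<integral>\<^sup>+h\<in>ball 0 r. ?w (y - s *\<^sub>R h) \<partial>lborel) \<partial>lborel)"
    proof (rule nn_integral_cong)
      fix y :: "real ^ 'n"
      have "(\<lambda>h. ?w (y - s *\<^sub>R h) * indicator (ball 0 r) h) \<in> borel_measurable lborel"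
        by measurable
      from nn_integral_cmult[OF this, of "g y"]
      show "(\<integral>\<^sup>+h. g y * ?w (y - s *\<^sub>R h) * indicator (ball 0 r) h \<partial>lborel)
          = g y * (\<integral>\<^sup>+h\<in>ball 0 r. ?w (y - s *\<^sub>R h) \<partial>lborel)"
        by (simp add: mult_ac)
    qed
    also have "\<dots> \<le> (\<integral>\<^sup>+y. g y * (ennreal (C * r ^ CARD('n)) * ?w y) \<partial>lborel)"
    proof (intro nn_integral_mono_AE)
      show "AE y in lborel. g y * (\<integral>\<^sup>+h\<in>ball 0 r. ?w (y - s *\<^sub>R h) \<partial>lborel)
          \<le> g y * (ennreal (C * r ^ CARD('n)) * ?w y)"
        using AE_lborel_singleton[of "0 :: real ^ 'n"]
      proof eventually_elim
        case (elim y)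
        then show ?case
          using C(2)[OF r s elim] C(1) r
          by (intro mult_left_mono) (auto simp: ennreal_mult power_weight_nonneg)
      qed
    qed
    also have "\<dots> = ennreal (C * r ^ CARD('n)) * (\<integral>\<^sup>+x. g x * ?w x \<partial>lborel)"
      by (subst nn_integral_cmult[symmetric]) (auto simp: mult_ac)
    finally show ?thesis .
  qed
  with C(1) show ?thesis by blast
qed

lemma weighted_segment_average:
  assumes "- real CARD('n) < \<theta>" "\<theta> \<le> 0"
  shows "\<exists>C>0. \<forall>r>0. \<forall>g\<in>borel_measurable borel.
           (\<integral>\<^sup>+x. (\<integral>\<^sup>+h\<in>ball (0 :: real ^ 'n) r. (\<integral>\<^sup>+s\<in>{0..1}. g (x + s *\<^sub>R h) \<partial>lborel) \<partial>lborel)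
               * ennreal (power_weight \<theta> x) \<partial>lborel)
             \<le> ennreal (C * r ^ CARD('n)) * (\<integral>\<^sup>+x. g x * ennreal (power_weight \<theta> x) \<partial>lborel)"
proof -
  let ?w = "\<lambda>x :: real ^ 'n. ennreal (power_weight \<theta> x)"
  obtain C where C: "C > 0" "\<And>r s g. r > 0 \<Longrightarrow> s \<in> {0..1} \<Longrightarrow> g \<in> borel_measurable borel \<Longrightarrow>
           (\<integral>\<^sup>+x. (\<integral>\<^sup>+h\<in>ball (0 :: real ^ 'n) r. g (x + s *\<^sub>R h) \<partial>lborel) * ?w x \<partial>lborel)
             \<le> ennreal (C * r ^ CARD('n)) * (\<integral>\<^sup>+x. g x * ?w x \<partial>lborel)"
    using weighted_ball_average[OF assms] by blast
  have "(\<integral>\<^sup>+x. (\<integral>\<^sup>+h\<in>ball 0 r. (\<integral>\<^sup>+s\<in>{0..1}. g (x + s *\<^sub>R h) \<partial>lborel) \<partial>lborel) * ?w x \<partial>lborel)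
             \<le> ennreal (C * r ^ CARD('n)) * (\<integral>\<^sup>+x. g x * ?w x \<partial>lborel)"
    if r: "r > 0" and [measurable]: "g \<in> borel_measurable borel"
    for r and g :: "real ^ 'n \<Rightarrow> ennreal"
  proof -
    let ?i = "indicator {0..1} :: real \<Rightarrow> ennreal"
    have [measurable]: "ball (0 :: real ^ 'n) r \<in> sets borel" by simp
    have "(\<integral>\<^sup>+h\<in>ball 0 r. (\<integral>\<^sup>+s\<in>{0..1}. g (x + s *\<^sub>R h) \<partial>lborel) \<partial>lborel)
        = (\<integral>\<^sup>+s. (\<integral>\<^sup>+h\<in>ball 0 r. g (x + s *\<^sub>R h) \<partial>lborel) * ?i s \<partial>lborel)" for x
    proof -
      have "(\<integral>\<^sup>+h\<in>ball 0 r. (\<integral>\<^sup>+s\<in>{0..1}. g (x + s *\<^sub>R h) \<partial>lborel) \<partial>lborel)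
          = (\<integral>\<^sup>+h. (\<integral>\<^sup>+s. g (x + s *\<^sub>R h) * ?i s * indicator (ball 0 r) h \<partial>lborel) \<partial>lborel)"
        by (subst nn_integral_multc) simp_all
      also have "\<dots> = (\<integral>\<^sup>+s. (\<integral>\<^sup>+h. g (x + s *\<^sub>R h) * ?i s * indicator (ball 0 r) h \<partial>lborel) \<partial>lborel)"
        by (rule lborel_pair.Fubini') measurable
      also have "\<dots> = (\<integral>\<^sup>+s. (\<integral>\<^sup>+h. g (x + s *\<^sub>R h) * indicator (ball 0 r) h * ?i s \<partial>lborel) \<partial>lborel)"
        by (simp add: mult_ac)
      also have "\<dots> = (\<integral>\<^sup>+s. (\<integral>\<^sup>+h\<in>ball 0 r. g (x + s *\<^sub>R h) \<partial>lborel) * ?i s \<partial>lborel)"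
        by (subst nn_integral_multc) simp_all
      finally show ?thesis .
    qed
    then have "(\<integral>\<^sup>+x. (\<integral>\<^sup>+h\<in>ball 0 r. (\<integral>\<^sup>+s\<in>{0..1}. g (x + s *\<^sub>R h) \<partial>lborel) \<partial>lborel) * ?w x \<partial>lborel)
        = (\<integral>\<^sup>+x. (\<integral>\<^sup>+s. (\<integral>\<^sup>+h\<in>ball 0 r. g (x + s *\<^sub>R h) \<partial>lborel) * ?i s * ?w x \<partial>lborel) \<partial>lborel)"
      by (subst nn_integral_multc) simp_all
    also have "\<dots> = (\<integral>\<^sup>+s. (\<integral>\<^sup>+x. (\<integral>\<^sup>+h\<in>ball 0 r. g (x + s *\<^sub>R h) \<partial>lborel) * ?i s * ?w x \<partial>lborel) \<partial>lborel)"
      by (rule lborel_pair.Fubini') measurable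
    also have "\<dots> \<le> (\<integral>\<^sup>+s. ennreal (C * r ^ CARD('n)) * (\<integral>\<^sup>+x. g x * ?w x \<partial>lborel) * ?i s \<partial>lborel)"
    proof (rule nn_integral_mono)
      fix s :: real
      have "(\<integral>\<^sup>+x. (\<integral>\<^sup>+h\<in>ball 0 r. g (x + s *\<^sub>R h) \<partial>lborel) * ?i s * ?w x \<partial>lborel)
          = (\<integral>\<^sup>+x. (\<integral>\<^sup>+h\<in>ball 0 r. g (x + s *\<^sub>R h) \<partial>lborel) * ?w x \<partial>lborel) * ?i s"
        by (cases "s \<in> {0..1}") auto
      also have "\<dots> \<le> ennreal (C * r ^ CARD('n)) * (\<integral>\<^sup>+x. g x * ?w x \<partial>lborel) * ?i s"
        using C(2)[OF r, of s g] by (cases "s \<in> {0..1}") auto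
      finally show "(\<integral>\<^sup>+x. (\<integral>\<^sup>+h\<in>ball 0 r. g (x + s *\<^sub>R h) \<partial>lborel) * ?i s * ?w x \<partial>lborel)
          \<le> ennreal (C * r ^ CARD('n)) * (\<integral>\<^sup>+x. g x * ?w x \<partial>lborel) * ?i s" .
    qed
    also have "\<dots> = ennreal (C * r ^ CARD('n)) * (\<integral>\<^sup>+x. g x * ?w x \<partial>lborel)"
      by (subst nn_integral_cmult_indicator) auto
    finally show ?thesis .
  qed
  with C(1) show ?thesis by blast
qed

section \<open>First-order Poincare and interpolation inequalities\<close>

lemma Lp_power_power_weight:
  "Lp_power p (power_weight \<theta>) f =
     (\<integral>\<^sup>+x. ennreal (\<bar>f x\<bar> powr p) * ennreal (power_weight \<theta> x) \<partial>lborel)"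
  unfolding Lp_power_def nn_integral_completion
  by (simp add: ennreal_mult power_weight_nonneg)

lemma sum_Lp_power_power_weight:
  assumes "finite I" "\<And>i. i \<in> I \<Longrightarrow> f i \<in> borel_measurable borel"
  shows "(\<integral>\<^sup>+x. ennreal (\<Sum>i\<in>I. \<bar>f i x\<bar> powr p) * ennreal (power_weight \<theta> x) \<partial>lborel)
    = (\<Sum>i\<in>I. Lp_power p (power_weight \<theta>) (f i))"
proof -
  have "(\<integral>\<^sup>+x. ennreal (\<Sum>i\<in>I. \<bar>f i x\<bar> powr p) * ennreal (power_weight \<theta> x) \<partial>lborel)
      = (\<integral>\<^sup>+x. (\<Sum>i\<in>I. ennreal (\<bar>f i x\<bar> powr p) * ennreal (power_weight \<theta> x)) \<partial>lborel)"
    by (simp add: sum_ennreal[symmetric] sum_distrib_right del: sum_ennreal)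
  also have "\<dots> = (\<Sum>i\<in>I. \<integral>\<^sup>+x. ennreal (\<bar>f i x\<bar> powr p) * ennreal (power_weight \<theta> x) \<partial>lborel)"
  proof (rule nn_integral_sum)
    fix i assume "i \<in> I"
    then have [measurable]: "f i \<in> borel_measurable borel" by (rule assms)
    show "(\<lambda>x. ennreal (\<bar>f i x\<bar> powr p) * ennreal (power_weight \<theta> x)) \<in> borel_measurable lborel"
      by measurable
  qed
  finally show ?thesis by (simp add: Lp_power_power_weight)
qed

lemma powr_sum_times_le:
  fixes a b :: "'a :: finite \<Rightarrow> real"
  assumes "\<And>i. \<bar>a i\<bar> \<le> R" "0 \<le> p"
  shows "\<bar>\<Sum>i\<in>UNIV. a i * b i\<bar> powr p
     \<le> R powr p * real CARD('a) powr p * (\<Sum>i\<in>UNIV. \<bar>b i\<bar> powr p)"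
proof -
  have R: "0 \<le> R" using assms(1)[of undefined] by linarith
  have "\<bar>\<Sum>i\<in>UNIV. a i * b i\<bar> \<le> (\<Sum>i\<in>UNIV. R * \<bar>b i\<bar>)"
    by (rule order_trans[OF sum_abs sum_mono]) (simp add: abs_mult mult_right_mono assms)
  then have "\<bar>\<Sum>i\<in>UNIV. a i * b i\<bar> powr p \<le> (R * (\<Sum>i\<in>UNIV. \<bar>b i\<bar>)) powr p"
    by (intro powr_mono2 assms) (auto simp: sum_distrib_left)
  also have "\<dots> = R powr p * (\<Sum>i\<in>UNIV. \<bar>b i\<bar>) powr p"
    using R by (simp add: powr_mult sum_nonneg)
  also have "\<dots> \<le> R powr p * (real CARD('a) powr p * (\<Sum>i\<in>UNIV. \<bar>b i\<bar> powr p))"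
    by (intro mult_left_mono powr_sum_le assms) auto
  finally show ?thesis by (simp add: mult.assoc)
qed

lemma abs_component_le:
  fixes h :: "real ^ 'n"
  shows "norm h \<le> R \<Longrightarrow> \<bar>h $ i\<bar> \<le> R"
  using component_le_norm_cart[of h i] by linarith

lemma smooth_continuous_line:
  fixes f :: "real ^ 'n \<Rightarrow> real"
  assumes "smooth f"
  shows "continuous_on A (\<lambda>s. f (x + s *\<^sub>R h))"
  by (rule continuous_on_compose2[OF smooth_continuous_on[OF assms, of UNIV]])
    (auto intro!: continuous_intros)

text \<open>For every \<open>h\<close> with \<open>|h| > 2 \<delta>\<close> the point \<open>x + h\<close> is outside the support of \<open>\<phi>\<close> whenever \<open>x\<close> is inside
it, so \<open>|\<phi>(x)|\<^sup>p\<close> is bounded by the mean of \<open>|h|\<^sup>p |\<nabla>\<phi>|\<^sup>p\<close> over the segment \<open>[x, x + h]\<close>.  The average is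
taken over a ball \<open>S\<close> of such vectors with \<open>|h| < 4 \<delta>\<close>.\<close>

lemma weighted_Poincare_first_order:
  assumes p: "1 \<le> p" and \<theta>: "- real CARD('n) < \<theta>" "\<theta> \<le> 0"
  shows "\<exists>C>0. \<forall>\<delta>>0. \<forall>x0. \<forall>\<phi>\<in>test_functions (ball (x0 :: real ^ 'n) \<delta>).
     Lp_power p (power_weight \<theta>) \<phi> \<le> ennreal (C * \<delta> powr p) *
        (\<Sum>i\<in>UNIV. Lp_power p (power_weight \<theta>) (partial_deriv i \<phi>))"
proof -
  let ?w = "\<lambda>x :: real ^ 'n. ennreal (power_weight \<theta> x)"
  define n where "n = CARD('n)"
  define v where "v = unit_ball_vol (real n)"
  have v: "v > 0" by (simp add: v_def)
  obtain C0 where C0: "C0 > 0" "\<And>r g. r > 0 \<Longrightarrow> g \<in> borel_measurable borel \<Longrightarrow>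
      (\<integral>\<^sup>+x. (\<integral>\<^sup>+h\<in>ball (0 :: real ^ 'n) r. (\<integral>\<^sup>+s\<in>{0..1}. g (x + s *\<^sub>R h) \<partial>lborel) \<partial>lborel) * ?w x \<partial>lborel)
       \<le> ennreal (C0 * r ^ n) * (\<integral>\<^sup>+x. g x * ?w x \<partial>lborel)"
    using weighted_segment_average[OF \<theta>] unfolding n_def by blast
  define C where "C = 4 powr p * real n powr p * C0 * 4 ^ n / v"
  have "C > 0" using v C0 by (simp add: C_def n_def)
  moreover have "Lp_power p (power_weight \<theta>) \<phi> \<le> ennreal (C * \<delta> powr p) *
        (\<Sum>i\<in>UNIV. Lp_power p (power_weight \<theta>) (partial_deriv i \<phi>))"
    if \<delta>: "\<delta> > 0" and \<phi>: "\<phi> \<in> test_functions (ball x0 \<delta>)" for \<delta> \<phi> and x0 :: "real ^ 'n"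
  proof -
    note sm = test_functions_smooth[OF \<phi>]
    have [measurable]: "\<phi> \<in> borel_measurable borel" "\<And>i. partial_deriv i \<phi> \<in> borel_measurable borel"
      by (intro smooth_borel smooth_partial_deriv sm)+
    have [measurable]: "ball a r \<in> sets borel" for a :: "real ^ 'n" and r by simp
    define g where "g y = ennreal (\<Sum>i\<in>UNIV. \<bar>partial_deriv i \<phi> y\<bar> powr p)" for y
    have [measurable]: "g \<in> borel_measurable borel" unfolding g_def by measurable
    define K where "K = (4 * \<delta>) powr p * real n powr p"
    obtain i0 :: 'n where True by blast
    define S where "S = ball ((3 * \<delta>) *\<^sub>R axis i0 (1 :: real)) \<delta>"
    have S: "2 * \<delta> < norm h" "norm h < 4 * \<delta>" if "h \<in> S" for h
    proof -
      have "norm ((3 * \<delta>) *\<^sub>R axis i0 (1 :: real) - h) < \<delta>" using that by (simp add: S_def dist_norm)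
      moreover have "norm ((3 * \<delta>) *\<^sub>R axis i0 (1 :: real)) = 3 * \<delta>" using \<delta> by simp
      ultimately show "2 * \<delta> < norm h" "norm h < 4 * \<delta>"
        using norm_triangle_ineq2[of "(3 * \<delta>) *\<^sub>R axis i0 (1 :: real)" h]
          norm_triangle_ineq3[of "(3 * \<delta>) *\<^sub>R axis i0 (1 :: real)" h] by linarith+
    qed
    have pointwise: "ennreal (\<bar>\<phi> x\<bar> powr p) \<le> ennreal K * (\<integral>\<^sup>+s\<in>{0..1}. g (x + s *\<^sub>R h) \<partial>lborel)"
      if h: "h \<in> S" for x h
    proof (cases "x \<in> ball x0 \<delta>")
      case False
      then show ?thesis by (simp add: test_functions_zero[OF \<phi>])
    next
      case True
      have "norm h \<le> dist x0 (x + h) + dist x0 x"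
        using norm_triangle_ineq4[of "x + h - x0" "x - x0"] by (simp add: dist_norm norm_minus_commute)
      then have "x + h \<notin> ball x0 \<delta>" using True S(1)[OF h] by auto
      then have "\<phi> (x + h) = 0" by (rule test_functions_zero[OF \<phi>])
      then have "ennreal (\<bar>\<phi> x\<bar> powr p) = ennreal (\<bar>\<phi> (x + 1 *\<^sub>R h) - \<phi> (x + 0 *\<^sub>R h)\<bar> powr p)"
        by simp
      also have "\<dots> \<le> (\<integral>\<^sup>+s\<in>{0..1}. ennreal (\<bar>\<Sum>i\<in>UNIV. h $ i * partial_deriv i \<phi> (x + s *\<^sub>R h)\<bar> powr p) \<partial>lborel)"
        by (intro increment_powr_le_nn_integral p smooth_has_line_derivative sm
            continuous_intros smooth_continuous_line smooth_partial_deriv)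
      also have "\<dots> \<le> (\<integral>\<^sup>+s. ennreal K * (g (x + s *\<^sub>R h) * indicator {0..1} s) \<partial>lborel)"
      proof (rule nn_integral_mono)
        fix s
        have "\<bar>\<Sum>i\<in>UNIV. h $ i * partial_deriv i \<phi> (x + s *\<^sub>R h)\<bar> powr p
            \<le> K * (\<Sum>i\<in>UNIV. \<bar>partial_deriv i \<phi> (x + s *\<^sub>R h)\<bar> powr p)"
          unfolding K_def n_def using S(2)[OF h] p
          by (intro powr_sum_times_le abs_component_le) auto
        then have "ennreal (\<bar>\<Sum>i\<in>UNIV. h $ i * partial_deriv i \<phi> (x + s *\<^sub>R h)\<bar> powr p)
            \<le> ennreal K * g (x + s *\<^sub>R h)"
          unfolding g_def by (subst ennreal_mult[symmetric]) (auto simp: K_def sum_nonneg intro!: ennreal_leI)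
        then show "ennreal (\<bar>\<Sum>i\<in>UNIV. h $ i * partial_deriv i \<phi> (x + s *\<^sub>R h)\<bar> powr p) * indicator {0..1} s
            \<le> ennreal K * (g (x + s *\<^sub>R h) * indicator {0..1} s)"
          by (auto simp: indicator_def)
      qed
      also have "\<dots> = ennreal K * (\<integral>\<^sup>+s\<in>{0..1}. g (x + s *\<^sub>R h) \<partial>lborel)"
        by (rule nn_integral_cmult) measurable
      finally show ?thesis .
    qed
    have averaged: "ennreal (v * \<delta> ^ n) * ennreal (\<bar>\<phi> x\<bar> powr p)
        \<le> ennreal K * (\<integral>\<^sup>+h\<in>ball 0 (4 * \<delta>). (\<integral>\<^sup>+s\<in>{0..1}. g (x + s *\<^sub>R h) \<partial>lborel) \<partial>lborel)" for x
    proof -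
      have "ennreal (v * \<delta> ^ n) * ennreal (\<bar>\<phi> x\<bar> powr p)
          = (\<integral>\<^sup>+h. ennreal (\<bar>\<phi> x\<bar> powr p) * indicator S h \<partial>lborel)"
        unfolding S_def using \<delta>
        by (subst nn_integral_cmult_indicator) (auto simp: emeasure_ball v_def n_def mult.commute)
      also have "\<dots> \<le> (\<integral>\<^sup>+h. ennreal K * ((\<integral>\<^sup>+s\<in>{0..1}. g (x + s *\<^sub>R h) \<partial>lborel) * indicator (ball 0 (4 * \<delta>)) h) \<partial>lborel)"
        using pointwise[of _ x] S(2) by (intro nn_integral_mono) (auto simp: indicator_def)
      also have "\<dots> = ennreal K * (\<integral>\<^sup>+h\<in>ball 0 (4 * \<delta>). (\<integral>\<^sup>+s\<in>{0..1}. g (x + s *\<^sub>R h) \<partial>lborel) \<partial>lborel)"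
        by (rule nn_integral_cmult) measurable
      finally show ?thesis .
    qed
    have "ennreal (v * \<delta> ^ n) * Lp_power p (power_weight \<theta>) \<phi>
        = (\<integral>\<^sup>+x. ennreal (v * \<delta> ^ n) * ennreal (\<bar>\<phi> x\<bar> powr p) * ?w x \<partial>lborel)"
      unfolding Lp_power_power_weight by (subst nn_integral_cmult[symmetric]) (simp_all add: mult.assoc)
    also have "\<dots> \<le> (\<integral>\<^sup>+x. ennreal K *
        ((\<integral>\<^sup>+h\<in>ball 0 (4 * \<delta>). (\<integral>\<^sup>+s\<in>{0..1}. g (x + s *\<^sub>R h) \<partial>lborel) \<partial>lborel) * ?w x) \<partial>lborel)"
      using averaged by (intro nn_integral_mono) (simp add: mult.assoc[symmetric] mult_right_mono)
    also have "\<dots> = ennreal K *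
        (\<integral>\<^sup>+x. (\<integral>\<^sup>+h\<in>ball 0 (4 * \<delta>). (\<integral>\<^sup>+s\<in>{0..1}. g (x + s *\<^sub>R h) \<partial>lborel) \<partial>lborel) * ?w x \<partial>lborel)"
      by (rule nn_integral_cmult) measurable
    also have "\<dots> \<le> ennreal K * (ennreal (C0 * (4 * \<delta>) ^ n) * (\<integral>\<^sup>+x. g x * ?w x \<partial>lborel))"
      using \<delta> by (intro mult_left_mono C0(2)) auto
    also have "(\<integral>\<^sup>+x. g x * ?w x \<partial>lborel) = (\<Sum>i\<in>UNIV. Lp_power p (power_weight \<theta>) (partial_deriv i \<phi>))"
      unfolding g_def by (intro sum_Lp_power_power_weight) auto
    finally have "Lp_power p (power_weight \<theta>) \<phi> \<le> ennreal (1 / (v * \<delta> ^ n)) *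
        (ennreal K * (ennreal (C0 * (4 * \<delta>) ^ n) *
          (\<Sum>i\<in>UNIV. Lp_power p (power_weight \<theta>) (partial_deriv i \<phi>))))"
      using v \<delta> by (intro ennreal_cmult_le_imp_le) auto
    also have "\<dots> = ennreal (1 / (v * \<delta> ^ n) * (K * (C0 * (4 * \<delta>) ^ n))) *
          (\<Sum>i\<in>UNIV. Lp_power p (power_weight \<theta>) (partial_deriv i \<phi>))"
      using v \<delta> C0(1) by (simp add: ennreal_mult[symmetric] mult.assoc[symmetric] K_def)
    also have "1 / (v * \<delta> ^ n) * (K * (C0 * (4 * \<delta>) ^ n)) = C * \<delta> powr p"
      using v \<delta> by (simp add: C_def K_def powr_mult power_mult_distrib)
    finally show ?thesis .
  qed
  ultimately show ?thesis by blast
qed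

lemma nn_integral_add3:
  assumes "f \<in> borel_measurable M" "g \<in> borel_measurable M" "h \<in> borel_measurable M"
  shows "(\<integral>\<^sup>+x. (f x + g x + h x) \<partial>M) = integral\<^sup>N M f + integral\<^sup>N M g + integral\<^sup>N M h"
  using assms by (simp add: nn_integral_add)

text \<open>Taylor's formula bounds \<open>|h \<bullet> \<nabla>\<phi>(x)|\<close> by \<open>|\<phi>(x + h)| + |\<phi>(x)|\<close> and the mean of \<open>|h|\<^sup>2 |\<nabla>\<^sup>2 \<phi>|\<close> over
\<open>[x, x + h]\<close>.  To recover \<open>|\<nabla>\<phi>(x)|\<close> on average, only those \<open>h\<close> are kept that point roughly in the
direction of the gradient: they fill a ball \<open>S\<close> of radius \<open>r / 4\<close>, on which
\<open>h \<bullet> \<nabla>\<phi>(x) \<ge> r |\<nabla>\<phi>(x)| / 4\<close>.  This ball depends on \<open>x\<close>, but the enlarged domain \<open>|h| < r\<close> used on the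
right-hand side does not.\<close>

lemma weighted_interpolation_first_order:
  assumes p: "1 \<le> p" and \<theta>: "- real CARD('n) < \<theta>" "\<theta> \<le> 0"
  shows "\<exists>C>0. \<forall>r>0. \<forall>\<phi> :: real ^ 'n \<Rightarrow> real. smooth \<phi> \<longrightarrow>
     (\<Sum>i\<in>UNIV. Lp_power p (power_weight \<theta>) (partial_deriv i \<phi>)) \<le>
       ennreal (C * r powr p) *
         (\<Sum>i\<in>UNIV. \<Sum>j\<in>UNIV. Lp_power p (power_weight \<theta>) (partial_deriv j (partial_deriv i \<phi>)))
       + ennreal (C / r powr p) * Lp_power p (power_weight \<theta>) \<phi>"
proof -
  let ?w = "\<lambda>x :: real ^ 'n. ennreal (power_weight \<theta> x)"
  let ?L = "Lp_power p (power_weight \<theta>)"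
  define n where "n = CARD('n)"
  have n: "n > 0" by (simp add: n_def)
  define v where "v = unit_ball_vol (real n)"
  have v: "v > 0" by (simp add: v_def)
  obtain C1 where C1: "C1 > 0" "\<And>r g. r > 0 \<Longrightarrow> g \<in> borel_measurable borel \<Longrightarrow>
      (\<integral>\<^sup>+x. (\<integral>\<^sup>+h\<in>ball (0 :: real ^ 'n) r. (\<integral>\<^sup>+s\<in>{0..1}. g (x + s *\<^sub>R h) \<partial>lborel) \<partial>lborel) * ?w x \<partial>lborel)
       \<le> ennreal (C1 * r ^ n) * (\<integral>\<^sup>+x. g x * ?w x \<partial>lborel)"
    using weighted_segment_average[OF \<theta>] unfolding n_def by blast
  obtain C2 where C2: "C2 > 0" "\<And>r s g. r > 0 \<Longrightarrow> s \<in> {0..1} \<Longrightarrow> g \<in> borel_measurable borel \<Longrightarrow>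
           (\<integral>\<^sup>+x. (\<integral>\<^sup>+h\<in>ball (0 :: real ^ 'n) r. g (x + s *\<^sub>R h) \<partial>lborel) * ?w x \<partial>lborel)
             \<le> ennreal (C2 * r ^ n) * (\<integral>\<^sup>+x. g x * ?w x \<partial>lborel)"
    using weighted_ball_average[OF \<theta>] unfolding n_def by blast
  define N where "N = real n powr p * real n powr p"
  define c where "c = 4 powr (- p) * v / 4 ^ n"
  define C where "C = real n * 3 powr p * (N * C1 + C2 + v) / c"
  have c: "c > 0" using v by (simp add: c_def)
  have N: "N > 0" using n by (simp add: N_def)
  have sum_pos: "N * C1 + C2 + v > 0" using N C1 C2 v by (intro add_pos_pos mult_pos_pos) auto
  have "C > 0" using n c sum_pos by (simp add: C_def)
  moreover have "(\<Sum>i\<in>UNIV. ?L (partial_deriv i \<phi>)) \<le>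
       ennreal (C * r powr p) * (\<Sum>i\<in>UNIV. \<Sum>j\<in>UNIV. ?L (partial_deriv j (partial_deriv i \<phi>)))
       + ennreal (C / r powr p) * ?L \<phi>"
    if r: "r > 0" and sm: "smooth \<phi>" for r and \<phi> :: "real ^ 'n \<Rightarrow> real"
  proof -
    define R where "R = r powr p"
    have R: "R > 0" using r by (simp add: R_def)
    have [measurable]: "\<phi> \<in> borel_measurable borel" "\<And>i. partial_deriv i \<phi> \<in> borel_measurable borel"
      "\<And>i j. partial_deriv j (partial_deriv i \<phi>) \<in> borel_measurable borel"
      by (intro smooth_borel smooth_partial_deriv sm)+
    have [measurable]: "ball a r \<in> sets borel" for a :: "real ^ 'n" and r by simp
    define g where "g y = ennreal (\<Sum>i\<in>UNIV. \<Sum>j\<in>UNIV. \<bar>partial_deriv j (partial_deriv i \<phi>) y\<bar> powr p)" for y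
    have g_meas [measurable]: "g \<in> borel_measurable borel" unfolding g_def by measurable
    define \<xi> :: "real ^ 'n \<Rightarrow> real ^ 'n" where "\<xi> x = (\<chi> i. partial_deriv i \<phi> x)" for x
    have [measurable]: "(\<lambda>x. norm (\<xi> x)) \<in> borel_measurable borel"
      unfolding \<xi>_def norm_vec_def L2_set_def by simp
    define a where "a x = ennreal (norm (\<xi> x) powr p)" for x
    have [measurable]: "a \<in> borel_measurable borel" unfolding a_def by measurable
    define b where "b x = ennreal (\<bar>\<phi> x\<bar> powr p)" for x
    have b_meas [measurable]: "b \<in> borel_measurable borel" unfolding b_def by measurable
    have Taylor: "ennreal (\<bar>\<Sum>i\<in>UNIV. h $ i * partial_deriv i \<phi> x\<bar> powr p)
        \<le> ennreal (3 powr p) * (b (x + h) + b x + ennreal (R * R * N) * (\<integral>\<^sup>+s\<in>{0..1}. g (x + s *\<^sub>R h) \<partial>lborel))"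
      if h: "norm h < r" for x h
    proof -
      define u where "u s = \<phi> (x + s *\<^sub>R h)" for s
      define u' where "u' s = (\<Sum>i\<in>UNIV. h $ i * partial_deriv i \<phi> (x + s *\<^sub>R h))" for s
      define u'' where "u'' s = (\<Sum>i\<in>UNIV. h $ i *
        (\<Sum>j\<in>UNIV. h $ j * partial_deriv j (partial_deriv i \<phi>) (x + s *\<^sub>R h)))" for s
      have u: "(u has_real_derivative u' s) (at s)" for s
        unfolding u_def u'_def by (rule smooth_has_line_derivative[OF sm])
      have u': "(u' has_real_derivative u'' s) (at s)" for s
        unfolding u'_def u''_def
        by (intro DERIV_sum DERIV_cmult smooth_has_line_derivative smooth_partial_deriv sm)
      \<comment> \<open>Chosen so that \<open>F 1 - F 0\<close> is the remainder of Taylor's formula and the derivative of \<open>F\<close>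
          involves \<open>u''\<close> alone.\<close>
      define F where "F s = (1 - s) * u' s + u s" for s
      have F: "(F has_real_derivative (1 - s) * u'' s) (at s)" for s
        unfolding F_def by (auto intro!: derivative_eq_intros u u')
      have "continuous_on {0..1} u''"
        unfolding u''_def
        by (intro continuous_intros smooth_continuous_line smooth_partial_deriv sm)
      then have "ennreal (\<bar>F 1 - F 0\<bar> powr p) \<le> (\<integral>\<^sup>+s\<in>{0..1}. ennreal (\<bar>(1 - s) * u'' s\<bar> powr p) \<partial>lborel)"
        by (intro increment_powr_le_nn_integral p F continuous_intros)
      also have "\<dots> \<le> (\<integral>\<^sup>+s. ennreal (R * R * N) * (g (x + s *\<^sub>R h) * indicator {0..1} s) \<partial>lborel)"
      proof (rule nn_integral_mono)
        fix s :: real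
        have "\<bar>(1 - s) * u'' s\<bar> powr p \<le> R * R * N * (\<Sum>i\<in>UNIV. \<Sum>j\<in>UNIV. \<bar>partial_deriv j (partial_deriv i \<phi>) (x + s *\<^sub>R h)\<bar> powr p)"
          if s: "s \<in> {0..1}"
        proof -
          have "\<bar>(1 - s) * u'' s\<bar> \<le> 1 * \<bar>u'' s\<bar>"
            unfolding abs_mult using s by (intro mult_right_mono) auto
          then have "\<bar>(1 - s) * u'' s\<bar> powr p \<le> \<bar>u'' s\<bar> powr p"
            using p by (intro powr_mono2) auto
          also have "\<dots> \<le> R * real n powr p * (\<Sum>i\<in>UNIV. \<bar>\<Sum>j\<in>UNIV. h $ j * partial_deriv j (partial_deriv i \<phi>) (x + s *\<^sub>R h)\<bar> powr p)"
            unfolding u''_def R_def n_def using h p by (intro powr_sum_times_le abs_component_le) auto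
          also have "\<dots> \<le> R * real n powr p * (\<Sum>i\<in>UNIV. R * real n powr p * (\<Sum>j\<in>UNIV. \<bar>partial_deriv j (partial_deriv i \<phi>) (x + s *\<^sub>R h)\<bar> powr p))"
            using R h p unfolding R_def n_def
            by (intro mult_left_mono sum_mono powr_sum_times_le abs_component_le) auto
          also have "\<dots> = R * R * N * (\<Sum>i\<in>UNIV. \<Sum>j\<in>UNIV. \<bar>partial_deriv j (partial_deriv i \<phi>) (x + s *\<^sub>R h)\<bar> powr p)"
            by (simp add: N_def sum_distrib_left[symmetric])
          finally show ?thesis .
        qed
        then have "ennreal (\<bar>(1 - s) * u'' s\<bar> powr p) \<le> ennreal (R * R * N) * g (x + s *\<^sub>R h)"
          if "s \<in> {0..1}"
          unfolding g_def using that N R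
          by (subst ennreal_mult[symmetric]) (auto simp: sum_nonneg intro!: ennreal_leI)
        then show "ennreal (\<bar>(1 - s) * u'' s\<bar> powr p) * indicator {0..1} s
            \<le> ennreal (R * R * N) * (g (x + s *\<^sub>R h) * indicator {0..1} s)"
          by (auto simp: indicator_def)
      qed
      also have "\<dots> = ennreal (R * R * N) * (\<integral>\<^sup>+s\<in>{0..1}. g (x + s *\<^sub>R h) \<partial>lborel)"
        by (rule nn_integral_cmult) measurable
      finally have rem: "ennreal (\<bar>F 1 - F 0\<bar> powr p)
          \<le> ennreal (R * R * N) * (\<integral>\<^sup>+s\<in>{0..1}. g (x + s *\<^sub>R h) \<partial>lborel)" .
      have "\<bar>u' 0\<bar> \<le> \<bar>u 1\<bar> + \<bar>u 0\<bar> + \<bar>F 1 - F 0\<bar>"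
        by (simp add: F_def)
      also have "\<dots> = (\<Sum>k\<in>{0, 1, 2 :: nat}. [\<bar>u 1\<bar>, \<bar>u 0\<bar>, \<bar>F 1 - F 0\<bar>] ! k)"
        by simp
      finally have "\<bar>u' 0\<bar> powr p \<le> (\<Sum>k\<in>{0, 1, 2 :: nat}. [\<bar>u 1\<bar>, \<bar>u 0\<bar>, \<bar>F 1 - F 0\<bar>] ! k) powr p"
        using p by (intro powr_mono2) auto
      also have "\<dots> \<le> real (card {0, 1, 2 :: nat}) powr p *
          (\<Sum>k\<in>{0, 1, 2 :: nat}. ([\<bar>u 1\<bar>, \<bar>u 0\<bar>, \<bar>F 1 - F 0\<bar>] ! k) powr p)"
        using p by (intro powr_sum_le) auto
      also have "\<dots> = 3 powr p * (\<bar>u 1\<bar> powr p + \<bar>u 0\<bar> powr p + \<bar>F 1 - F 0\<bar> powr p)"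
        by (simp add: add.assoc)
      finally have "ennreal (\<bar>u' 0\<bar> powr p) \<le> ennreal (3 powr p) *
          (ennreal (\<bar>u 1\<bar> powr p) + ennreal (\<bar>u 0\<bar> powr p) + ennreal (\<bar>F 1 - F 0\<bar> powr p))"
        by (simp add: ennreal_mult[symmetric] ennreal_plus[symmetric] ennreal_leI del: ennreal_plus)
      also have "\<dots> \<le> ennreal (3 powr p) *
          (b (x + h) + b x + ennreal (R * R * N) * (\<integral>\<^sup>+s\<in>{0..1}. g (x + s *\<^sub>R h) \<partial>lborel))"
        using rem by (intro mult_left_mono add_mono) (auto simp: u_def b_def)
      finally show ?thesis by (simp add: u'_def)
    qed
    have averaged: "ennreal (c * R * r ^ n) * a x \<le> ennreal (3 powr p) *
        ((\<integral>\<^sup>+h\<in>ball 0 r. b (x + 1 *\<^sub>R h) \<partial>lborel) + ennreal (v * r ^ n) * b x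
          + ennreal (R * R * N) * (\<integral>\<^sup>+h\<in>ball 0 r. (\<integral>\<^sup>+s\<in>{0..1}. g (x + s *\<^sub>R h) \<partial>lborel) \<partial>lborel))" for x
    proof (cases "\<xi> x = 0")
      case True
      then show ?thesis by (simp add: a_def)
    next
      case False
      define \<nu> where "\<nu> = (r / 2 / norm (\<xi> x)) *\<^sub>R \<xi> x"
      have \<nu>: "norm \<nu> = r / 2" "\<nu> \<bullet> \<xi> x = r / 2 * norm (\<xi> x)"
        using False r by (auto simp: \<nu>_def dot_square_norm power2_eq_square)
      define S where "S = ball \<nu> (r / 4)"
      have S: "norm h < r" "r / 4 * norm (\<xi> x) \<le> \<bar>\<Sum>i\<in>UNIV. h $ i * partial_deriv i \<phi> x\<bar>" if "h \<in> S" for h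
      proof -
        have d: "norm (\<nu> - h) < r / 4" using that by (simp add: S_def dist_norm)
        show "norm h < r" using norm_triangle_ineq2[of h \<nu>] d \<nu>(1) r by (simp add: norm_minus_commute)
        have "(\<nu> - h) \<bullet> \<xi> x \<le> norm (\<nu> - h) * norm (\<xi> x)" by (rule norm_cauchy_schwarz)
        also have "\<dots> \<le> r / 4 * norm (\<xi> x)" using d by (intro mult_right_mono) auto
        finally have "r / 4 * norm (\<xi> x) \<le> h \<bullet> \<xi> x"
          using \<nu>(2) by (simp add: inner_diff_left)
        also have "h \<bullet> \<xi> x = (\<Sum>i\<in>UNIV. h $ i * partial_deriv i \<phi> x)"
          by (simp add: inner_vec_def \<xi>_def)
        finally show "r / 4 * norm (\<xi> x) \<le> \<bar>\<Sum>i\<in>UNIV. h $ i * partial_deriv i \<phi> x\<bar>" by linarith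
      qed
      have "ennreal (c * R * r ^ n) * a x = (\<integral>\<^sup>+h. ennreal ((r / 4 * norm (\<xi> x)) powr p) * indicator S h \<partial>lborel)"
      proof -
        have "(\<integral>\<^sup>+h. ennreal ((r / 4 * norm (\<xi> x)) powr p) * indicator S h \<partial>lborel)
            = ennreal ((r / 4 * norm (\<xi> x)) powr p) * ennreal (v * (r / 4) ^ n)"
          unfolding S_def using r
          by (subst nn_integral_cmult_indicator) (auto simp: emeasure_ball v_def n_def)
        also have "\<dots> = ennreal (c * R * r ^ n) * a x"
          using r v c R unfolding a_def
          by (simp add: ennreal_mult[symmetric] c_def R_def powr_mult powr_divide powr_minus power_divide
              divide_simps mult_ac)
        finally show ?thesis ..
      qed
      also have "\<dots> \<le> (\<integral>\<^sup>+h. ennreal (3 powr p) * (b (x + 1 *\<^sub>R h) * indicator (ball 0 r) h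
           + b x * indicator (ball 0 r) h
           + ennreal (R * R * N) * ((\<integral>\<^sup>+s\<in>{0..1}. g (x + s *\<^sub>R h) \<partial>lborel) * indicator (ball 0 r) h)) \<partial>lborel)"
      proof (rule nn_integral_mono)
        fix h
        have "ennreal ((r / 4 * norm (\<xi> x)) powr p) \<le> ennreal (3 powr p) * (b (x + h) + b x + ennreal (R * R * N) * (\<integral>\<^sup>+s\<in>{0..1}. g (x + s *\<^sub>R h) \<partial>lborel))"
          if "h \<in> S"
          using S[OF that] r p
          by (intro order_trans[OF ennreal_leI Taylor] powr_mono2) auto
        then show "ennreal ((r / 4 * norm (\<xi> x)) powr p) * indicator S h \<le>
          ennreal (3 powr p) * (b (x + 1 *\<^sub>R h) * indicator (ball 0 r) h + b x * indicator (ball 0 r) h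
           + ennreal (R * R * N) * ((\<integral>\<^sup>+s\<in>{0..1}. g (x + s *\<^sub>R h) \<partial>lborel) * indicator (ball 0 r) h))"
          using S(1) by (auto simp: indicator_def)
      qed
      also have "\<dots> = ennreal (3 powr p) * (\<integral>\<^sup>+h. (b (x + 1 *\<^sub>R h) * indicator (ball 0 r) h
           + b x * indicator (ball 0 r) h
           + ennreal (R * R * N) * ((\<integral>\<^sup>+s\<in>{0..1}. g (x + s *\<^sub>R h) \<partial>lborel) * indicator (ball 0 r) h)) \<partial>lborel)"
        by (rule nn_integral_cmult) measurable
      also have "(\<integral>\<^sup>+h. (b (x + 1 *\<^sub>R h) * indicator (ball 0 r) h
           + b x * indicator (ball 0 r) h
           + ennreal (R * R * N) * ((\<integral>\<^sup>+s\<in>{0..1}. g (x + s *\<^sub>R h) \<partial>lborel) * indicator (ball 0 r) h)) \<partial>lborel)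
         = (\<integral>\<^sup>+h\<in>ball 0 r. b (x + 1 *\<^sub>R h) \<partial>lborel) + (\<integral>\<^sup>+h. b x * indicator (ball 0 r) (h :: real ^ 'n) \<partial>lborel)
           + (\<integral>\<^sup>+h. ennreal (R * R * N) * ((\<integral>\<^sup>+s\<in>{0..1}. g (x + s *\<^sub>R h) \<partial>lborel) * indicator (ball 0 r) h) \<partial>lborel)"
        by (rule nn_integral_add3) measurable
      also have "(\<integral>\<^sup>+h. b x * indicator (ball 0 r) (h :: real ^ 'n) \<partial>lborel) = ennreal (v * r ^ n) * b x"
        using r by (subst nn_integral_cmult_indicator) (auto simp: emeasure_ball v_def n_def mult.commute)
      also have "(\<integral>\<^sup>+h. ennreal (R * R * N) * ((\<integral>\<^sup>+s\<in>{0..1}. g (x + s *\<^sub>R h) \<partial>lborel) * indicator (ball 0 r) h) \<partial>lborel)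
          = ennreal (R * R * N) * (\<integral>\<^sup>+h\<in>ball 0 r. (\<integral>\<^sup>+s\<in>{0..1}. g (x + s *\<^sub>R h) \<partial>lborel) \<partial>lborel)"
        by (rule nn_integral_cmult) measurable
      finally show ?thesis .
    qed
    define E0 where "E0 = ?L \<phi>"
    define E2 where "E2 = (\<Sum>i\<in>UNIV. \<Sum>j\<in>UNIV. ?L (partial_deriv j (partial_deriv i \<phi>)))"
    define A where "A = (\<integral>\<^sup>+x. a x * ?w x \<partial>lborel)"
    have int_b: "(\<integral>\<^sup>+x. b x * ?w x \<partial>lborel) = E0"
      by (simp add: E0_def b_def Lp_power_power_weight)
    have int_g: "(\<integral>\<^sup>+x. g x * ?w x \<partial>lborel) = E2"
    proof -
      have "(\<integral>\<^sup>+x. g x * ?w x \<partial>lborel) =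
         (\<integral>\<^sup>+x. ennreal (\<Sum>(i, j)\<in>UNIV \<times> UNIV. \<bar>partial_deriv j (partial_deriv i \<phi>) x\<bar> powr p) * ?w x \<partial>lborel)"
        unfolding g_def sum.cartesian_product ..
      also have "\<dots> = (\<Sum>(i, j)\<in>UNIV \<times> UNIV. ?L (partial_deriv j (partial_deriv i \<phi>)))"
        using sum_Lp_power_power_weight[of "UNIV \<times> UNIV" "\<lambda>(i, j). partial_deriv j (partial_deriv i \<phi>)" p \<theta>]
        by (simp add: case_prod_unfold)
      finally show ?thesis by (simp add: E2_def sum.cartesian_product)
    qed
    have "ennreal (c * R * r ^ n) * A = (\<integral>\<^sup>+x. ennreal (c * R * r ^ n) * (a x * ?w x) \<partial>lborel)"
      unfolding A_def by (rule nn_integral_cmult[symmetric]) measurable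
    also have "\<dots> \<le> (\<integral>\<^sup>+x. ennreal (3 powr p) * (
         (\<integral>\<^sup>+h\<in>ball 0 r. b (x + 1 *\<^sub>R h) \<partial>lborel) * ?w x + ennreal (v * r ^ n) * (b x * ?w x)
          + ennreal (R * R * N) * ((\<integral>\<^sup>+h\<in>ball 0 r. (\<integral>\<^sup>+s\<in>{0..1}. g (x + s *\<^sub>R h) \<partial>lborel) \<partial>lborel) * ?w x)) \<partial>lborel)"
    proof (rule nn_integral_mono)
      fix x
      show "ennreal (c * R * r ^ n) * (a x * ?w x) \<le> ennreal (3 powr p) * (
         (\<integral>\<^sup>+h\<in>ball 0 r. b (x + 1 *\<^sub>R h) \<partial>lborel) * ?w x + ennreal (v * r ^ n) * (b x * ?w x)
          + ennreal (R * R * N) * ((\<integral>\<^sup>+h\<in>ball 0 r. (\<integral>\<^sup>+s\<in>{0..1}. g (x + s *\<^sub>R h) \<partial>lborel) \<partial>lborel) * ?w x))"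
        using mult_right_mono[OF averaged[of x], of "?w x"]
        by (simp only: mult.assoc distrib_right zero_le)
    qed
    also have "\<dots> = ennreal (3 powr p) * (\<integral>\<^sup>+x. (
         (\<integral>\<^sup>+h\<in>ball 0 r. b (x + 1 *\<^sub>R h) \<partial>lborel) * ?w x + ennreal (v * r ^ n) * (b x * ?w x)
          + ennreal (R * R * N) * ((\<integral>\<^sup>+h\<in>ball 0 r. (\<integral>\<^sup>+s\<in>{0..1}. g (x + s *\<^sub>R h) \<partial>lborel) \<partial>lborel) * ?w x)) \<partial>lborel)"
      by (rule nn_integral_cmult) measurable
    also have "(\<integral>\<^sup>+x. (
         (\<integral>\<^sup>+h\<in>ball 0 r. b (x + 1 *\<^sub>R h) \<partial>lborel) * ?w x + ennreal (v * r ^ n) * (b x * ?w x)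
          + ennreal (R * R * N) * ((\<integral>\<^sup>+h\<in>ball 0 r. (\<integral>\<^sup>+s\<in>{0..1}. g (x + s *\<^sub>R h) \<partial>lborel) \<partial>lborel) * ?w x)) \<partial>lborel)
       = (\<integral>\<^sup>+x. (\<integral>\<^sup>+h\<in>ball 0 r. b (x + 1 *\<^sub>R h) \<partial>lborel) * ?w x \<partial>lborel)
         + (\<integral>\<^sup>+x. ennreal (v * r ^ n) * (b x * ?w x) \<partial>lborel)
         + (\<integral>\<^sup>+x. ennreal (R * R * N) * ((\<integral>\<^sup>+h\<in>ball 0 r. (\<integral>\<^sup>+s\<in>{0..1}. g (x + s *\<^sub>R h) \<partial>lborel) \<partial>lborel) * ?w x) \<partial>lborel)"
      by (rule nn_integral_add3) measurable
    also have "(\<integral>\<^sup>+x. ennreal (v * r ^ n) * (b x * ?w x) \<partial>lborel) = ennreal (v * r ^ n) * E0"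
      unfolding int_b[symmetric] by (rule nn_integral_cmult) measurable
    also have "(\<integral>\<^sup>+x. ennreal (R * R * N) * ((\<integral>\<^sup>+h\<in>ball 0 r. (\<integral>\<^sup>+s\<in>{0..1}. g (x + s *\<^sub>R h) \<partial>lborel) \<partial>lborel) * ?w x) \<partial>lborel)
       = ennreal (R * R * N) * (\<integral>\<^sup>+x. (\<integral>\<^sup>+h\<in>ball 0 r. (\<integral>\<^sup>+s\<in>{0..1}. g (x + s *\<^sub>R h) \<partial>lborel) \<partial>lborel) * ?w x \<partial>lborel)"
      by (rule nn_integral_cmult) measurable
    also have "ennreal (3 powr p) * (
         (\<integral>\<^sup>+x. (\<integral>\<^sup>+h\<in>ball 0 r. b (x + 1 *\<^sub>R h) \<partial>lborel) * ?w x \<partial>lborel)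
         + ennreal (v * r ^ n) * E0
         + ennreal (R * R * N) * (\<integral>\<^sup>+x. (\<integral>\<^sup>+h\<in>ball 0 r. (\<integral>\<^sup>+s\<in>{0..1}. g (x + s *\<^sub>R h) \<partial>lborel) \<partial>lborel) * ?w x \<partial>lborel))
       \<le> ennreal (3 powr p) * (ennreal (C2 * r ^ n) * E0 + ennreal (v * r ^ n) * E0
         + ennreal (R * R * N) * (ennreal (C1 * r ^ n) * E2))"
      using C1(2)[OF r g_meas] C2(2)[OF r _ b_meas, of 1] unfolding int_b int_g
      by (intro mult_left_mono add_mono) auto
    also have "\<dots> = ennreal (3 powr p * (C2 + v) * r ^ n) * E0 + ennreal (3 powr p * R * R * N * C1 * r ^ n) * E2"
      using r R N C1(1) C2(1) v
      by (simp add: ennreal_mult distrib_left distrib_right mult_ac add_nonneg_nonneg)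
    finally have "A \<le> ennreal (1 / (c * R * r ^ n)) *
        (ennreal (3 powr p * (C2 + v) * r ^ n) * E0 + ennreal (3 powr p * R * R * N * C1 * r ^ n) * E2)"
      using c R r by (intro ennreal_cmult_le_imp_le) auto
    also have "\<dots> = ennreal (1 / (c * R * r ^ n) * (3 powr p * (C2 + v) * r ^ n)) * E0
        + ennreal (1 / (c * R * r ^ n) * (3 powr p * R * R * N * C1 * r ^ n)) * E2"
      using c R r N C1(1) C2(1) v
      by (subst (1 2) ennreal_mult) (auto simp: distrib_left mult.assoc)
    also have "1 / (c * R * r ^ n) * (3 powr p * (C2 + v) * r ^ n) = 3 powr p * (C2 + v) / c / R"
      using c R r by (simp add: field_simps)
    also have "1 / (c * R * r ^ n) * (3 powr p * R * R * N * C1 * r ^ n) = 3 powr p * (N * C1) / c * R"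
      using c R r by (simp add: field_simps)
    finally have A_le: "A \<le> ennreal (3 powr p * (C2 + v) / c / R) * E0 + ennreal (3 powr p * (N * C1) / c * R) * E2" .
    have "(\<Sum>i\<in>UNIV. ?L (partial_deriv i \<phi>)) \<le> (\<Sum>i\<in>(UNIV :: 'n set). A)"
    proof (rule sum_mono)
      fix i
      have "\<bar>partial_deriv i \<phi> x\<bar> \<le> norm (\<xi> x)" for x
        using component_le_norm_cart[of "\<xi> x" i] by (simp add: \<xi>_def)
      then show "?L (partial_deriv i \<phi>) \<le> A"
        unfolding Lp_power_power_weight A_def a_def using p
        by (intro nn_integral_mono mult_right_mono ennreal_leI powr_mono2) auto
    qed
    also have "\<dots> = ennreal (real n) * A" by (simp add: n_def ennreal_of_nat_eq_real_of_nat)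
    also have "\<dots> \<le> ennreal (real n) * (ennreal (3 powr p * (C2 + v) / c / R) * E0 + ennreal (3 powr p * (N * C1) / c * R) * E2)"
      by (intro mult_left_mono A_le) auto
    also have "\<dots> = ennreal (real n * (3 powr p * (C2 + v) / c / R)) * E0 + ennreal (real n * (3 powr p * (N * C1) / c * R)) * E2"
      using c R r N C1(1) C2(1) v
      by (subst (1 2) ennreal_mult) (auto simp: distrib_left mult.assoc)
    also have "\<dots> \<le> ennreal (C / R) * E0 + ennreal (C * R) * E2"
    proof (intro add_mono mult_right_mono ennreal_leI)
      have "real n * 3 powr p * (C2 + v) / c / R \<le> C / R"
        unfolding C_def using c R N C1(1)
        by (intro divide_right_mono mult_left_mono) auto
      then show "real n * (3 powr p * (C2 + v) / c / R) \<le> C / R" by simp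
      have "real n * 3 powr p * (N * C1) / c * R \<le> C * R"
        unfolding C_def using c R C2(1) v
        by (intro mult_right_mono divide_right_mono mult_left_mono) auto
      then show "real n * (3 powr p * (N * C1) / c * R) \<le> C * R" by simp
    qed auto
    finally show ?thesis unfolding E0_def E2_def R_def by (simp add: add.commute)
  qed
  ultimately show ?thesis by blast
qed

section \<open>Poincare and interpolation inequalities of higher order\<close>

text \<open>A substitute for the \<open>p\<close>-th power of the norm of \<open>\<nabla>\<^sup>k f\<close> in \<open>L\<^sup>p(w)\<close>, equivalent to it up to constants
that depend only on \<open>n\<close>, \<open>k\<close>, \<open>p\<close>; being a sum, it passes from order \<open>k\<close> to \<open>k + 1\<close> by applying a
first-order statement to every summand.\<close>

definition energy :: "real \<Rightarrow> real \<Rightarrow> nat \<Rightarrow> (real ^ 'n::finite \<Rightarrow> real) \<Rightarrow> ennreal" where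
  "energy p \<theta> k f = (\<Sum>ix | length ix = k. Lp_power p (power_weight \<theta>) (iter_partial ix f))"

definition multi_index_count :: "'n::finite itself \<Rightarrow> nat \<Rightarrow> real" where
  "multi_index_count _ k = real (card {ix :: 'n list. length ix = k})"

lemma finite_lists_of_length: "finite {ix :: 'n::finite list. length ix = k}"
  using finite_lists_length_eq[of "UNIV :: 'n set" k] by simp

lemma multi_index_count_pos: "0 < multi_index_count TYPE('n::finite) k"
proof -
  have "replicate k undefined \<in> {ix :: 'n list. length ix = k}" by simp
  then have "card {ix :: 'n list. length ix = k} \<noteq> 0"
    using finite_lists_of_length by (metis card_0_eq empty_iff)
  then show ?thesis by (simp add: multi_index_count_def)
qed

lemma sum_lists_Suc:
  fixes F :: "'n::finite list \<Rightarrow> 'b::comm_monoid_add"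
  shows "(\<Sum>ix | length ix = Suc k. F ix) = (\<Sum>ix | length ix = k. \<Sum>i\<in>UNIV. F (i # ix))"
proof -
  have "{ix :: 'n list. length ix = Suc k} = (\<lambda>(ix, i). i # ix) ` ({ix. length ix = k} \<times> UNIV)"
    by (force simp: length_Suc_conv)
  then have "(\<Sum>ix | length ix = Suc k. F ix)
      = (\<Sum>y\<in>{ix. length ix = k} \<times> UNIV. F ((\<lambda>(ix, i). i # ix) y))"
    by (simp add: sum.reindex inj_on_def split: prod.split)
  also have "\<dots> = (\<Sum>ix | length ix = k. \<Sum>i\<in>UNIV. F (i # ix))"
    by (simp add: sum.cartesian_product case_prod_unfold)
  finally show ?thesis .
qed

lemma energy_0: "energy p \<theta> 0 f = Lp_power p (power_weight \<theta>) f"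
proof -
  have "{ix :: 'a list. length ix = 0} = {[]}" by auto
  then show ?thesis by (simp add: energy_def)
qed

lemma Lp_power_le_energy:
  "length ix = k \<Longrightarrow> Lp_power p (power_weight \<theta>) (iter_partial ix f) \<le> energy p \<theta> k f"
  unfolding energy_def
  by (rule member_le_sum[of ix]) (auto simp: finite_lists_of_length)

lemma energy_le_grad_norm:
  fixes f :: "real ^ 'n \<Rightarrow> real"
  assumes "0 \<le> p"
  shows "energy p \<theta> k f \<le>
    ennreal (multi_index_count TYPE('n) k) * Lp_power p (power_weight \<theta>) (grad_norm k f)"
proof -
  have "Lp_power p (power_weight \<theta>) (iter_partial ix f) \<le> Lp_power p (power_weight \<theta>) (grad_norm k f)"
    if "length ix = k" for ix
  proof -
    have "\<bar>iter_partial ix f x\<bar> \<le> grad_norm k f x" for x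
      using member_le_L2_set[OF finite_lists_of_length[of k], of ix "\<lambda>ix. \<bar>iter_partial ix f x\<bar>"] that
      by (simp add: grad_norm_def L2_set_def)
    then show ?thesis
      unfolding Lp_power_power_weight using assms
      by (intro nn_integral_mono mult_right_mono ennreal_leI powr_mono2)
        (auto intro: order_trans[OF _ abs_ge_self])
  qed
  then have "energy p \<theta> k f \<le> (\<Sum>ix :: 'n list | length ix = k. Lp_power p (power_weight \<theta>) (grad_norm k f))"
    unfolding energy_def by (intro sum_mono) simp
  then show ?thesis by (simp add: multi_index_count_def ennreal_of_nat_eq_real_of_nat)
qed

lemma grad_norm_le_energy:
  fixes f :: "real ^ 'n \<Rightarrow> real"
  assumes "0 \<le> p" and sm: "smooth f"
  shows "Lp_power p (power_weight \<theta>) (grad_norm k f) \<le>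
    ennreal (multi_index_count TYPE('n) k powr p) * energy p \<theta> k f"
proof -
  let ?I = "{ix :: 'n list. length ix = k}"
  let ?N = "multi_index_count TYPE('n) k"
  have [measurable]: "iter_partial ix f \<in> borel_measurable borel" for ix
    by (intro smooth_borel smooth_iter_partial sm)
  have "\<bar>grad_norm k f x\<bar> powr p \<le> ?N powr p * (\<Sum>ix\<in>?I. \<bar>iter_partial ix f x\<bar> powr p)" for x
  proof -
    have "\<bar>grad_norm k f x\<bar> \<le> (\<Sum>ix\<in>?I. \<bar>iter_partial ix f x\<bar>)"
      using L2_set_le_sum_abs[of "\<lambda>ix. iter_partial ix f x" ?I] by (simp add: grad_norm_def)
    then have "\<bar>grad_norm k f x\<bar> powr p \<le> (\<Sum>ix\<in>?I. \<bar>iter_partial ix f x\<bar>) powr p"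
      using assms by (intro powr_mono2) auto
    also have "\<dots> \<le> ?N powr p * (\<Sum>ix\<in>?I. \<bar>iter_partial ix f x\<bar> powr p)"
      unfolding multi_index_count_def using assms
      by (intro powr_sum_le finite_lists_of_length) auto
    finally show ?thesis .
  qed
  then have "Lp_power p (power_weight \<theta>) (grad_norm k f) \<le>
      (\<integral>\<^sup>+x. ennreal (?N powr p * (\<Sum>ix\<in>?I. \<bar>iter_partial ix f x\<bar> powr p)) * ennreal (power_weight \<theta> x) \<partial>lborel)"
    unfolding Lp_power_power_weight by (intro nn_integral_mono mult_right_mono ennreal_leI) auto
  also have "\<dots> = (\<integral>\<^sup>+x. ennreal (?N powr p) *
      (ennreal (\<Sum>ix\<in>?I. \<bar>iter_partial ix f x\<bar> powr p) * ennreal (power_weight \<theta> x)) \<partial>lborel)"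
    by (intro nn_integral_cong) (simp add: ennreal_mult sum_nonneg mult.assoc)
  also have "\<dots> = ennreal (?N powr p) * (\<integral>\<^sup>+x. ennreal (\<Sum>ix\<in>?I. \<bar>iter_partial ix f x\<bar> powr p)
       * ennreal (power_weight \<theta> x) \<partial>lborel)"
    by (rule nn_integral_cmult) measurable
  also have "(\<integral>\<^sup>+x. ennreal (\<Sum>ix\<in>?I. \<bar>iter_partial ix f x\<bar> powr p)
       * ennreal (power_weight \<theta> x) \<partial>lborel) = energy p \<theta> k f"
    unfolding energy_def by (intro sum_Lp_power_power_weight finite_lists_of_length) auto
  finally show ?thesis .
qed

lemma Lp_power_test_function_finite:
  fixes f :: "real ^ 'n \<Rightarrow> real"
  assumes p: "0 \<le> p" and \<theta>: "- real CARD('n) < \<theta>" "\<theta> \<le> 0" and f: "f \<in> test_functions \<Omega>"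
  shows "Lp_power p (power_weight \<theta>) f < \<infinity>"
proof -
  obtain B R where BR: "B > 0" "R > 0" "\<And>x. \<bar>f x\<bar> \<le> B" "\<And>x. norm x \<ge> R \<Longrightarrow> f x = 0"
    by (rule test_functions_bounded[OF f]) blast
  obtain C where C: "\<And>R. R > 0 \<Longrightarrow> (\<integral>\<^sup>+z\<in>ball (0 :: real ^ 'n) R. ennreal (power_weight \<theta> z) \<partial>lborel)
           \<le> ennreal (C * R powr (real CARD('n) + \<theta>))"
    using power_weight_integral_ball[OF \<theta>] by blast
  have "Lp_power p (power_weight \<theta>) f \<le>
      (\<integral>\<^sup>+x. ennreal (B powr p) * (ennreal (power_weight \<theta> x) * indicator (ball 0 R) (x :: real ^ 'n)) \<partial>lborel)"
    unfolding Lp_power_power_weight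
  proof (rule nn_integral_mono)
    fix x
    have "\<bar>f x\<bar> powr p \<le> B powr p" using p BR(3) by (intro powr_mono2) auto
    then show "ennreal (\<bar>f x\<bar> powr p) * ennreal (power_weight \<theta> x)
        \<le> ennreal (B powr p) * (ennreal (power_weight \<theta> x) * indicator (ball 0 R) x)"
      using BR(4)[of x] by (auto simp: indicator_def intro!: mult_right_mono ennreal_leI)
  qed
  also have "\<dots> = ennreal (B powr p) * (\<integral>\<^sup>+x\<in>ball (0 :: real ^ 'n) R. ennreal (power_weight \<theta> x) \<partial>lborel)"
    by (intro nn_integral_cmult borel_measurable_times_ennreal borel_measurable_indicator) auto
  also have "\<dots> < \<infinity>"
    using C[OF BR(2)] by (auto simp: ennreal_mult_less_top intro: le_less_trans)
  finally show ?thesis .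
qed

lemma energy_test_function_finite:
  fixes f :: "real ^ 'n \<Rightarrow> real"
  assumes "0 \<le> p" "- real CARD('n) < \<theta>" "\<theta> \<le> 0" "f \<in> test_functions \<Omega>"
  shows "energy p \<theta> k f < \<infinity>"
  unfolding energy_def
  using Lp_power_test_function_finite[OF assms(1-3) test_functions_iter_partial[OF assms(4)]]
  by (simp add: finite_lists_of_length)

lemma weighted_Poincare:
  assumes p: "1 \<le> p" and \<theta>: "- real CARD('n) < \<theta>" "\<theta> \<le> 0"
  shows "\<exists>C>0. \<forall>k. \<forall>\<delta>>0. \<forall>x0. \<forall>\<phi>\<in>test_functions (ball (x0 :: real ^ 'n) \<delta>).
     Lp_power p (power_weight \<theta>) \<phi> \<le> ennreal ((C * \<delta> powr p) ^ k) * energy p \<theta> k \<phi>"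
proof -
  obtain C where C: "C > 0" "\<And>\<delta> x0 \<phi>. \<delta> > 0 \<Longrightarrow> \<phi> \<in> test_functions (ball (x0 :: real ^ 'n) \<delta>) \<Longrightarrow>
     Lp_power p (power_weight \<theta>) \<phi> \<le> ennreal (C * \<delta> powr p) *
        (\<Sum>i\<in>UNIV. Lp_power p (power_weight \<theta>) (partial_deriv i \<phi>))"
    using weighted_Poincare_first_order[OF assms] by blast
  have "Lp_power p (power_weight \<theta>) \<phi> \<le> ennreal ((C * \<delta> powr p) ^ k) * energy p \<theta> k \<phi>"
    if \<delta>: "\<delta> > 0" and \<phi>: "\<phi> \<in> test_functions (ball x0 \<delta>)" for k \<delta> \<phi> and x0 :: "real ^ 'n"
  proof (induction k)
    case 0
    then show ?case by (simp add: energy_0)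
  next
    case (Suc k)
    have "energy p \<theta> k \<phi> \<le> (\<Sum>ix | length ix = k. ennreal (C * \<delta> powr p) *
        (\<Sum>i\<in>UNIV. Lp_power p (power_weight \<theta>) (partial_deriv i (iter_partial ix \<phi>))))"
      unfolding energy_def
      by (intro sum_mono C(2)[OF \<delta>, of _ x0] test_functions_iter_partial \<phi>)
    also have "\<dots> = ennreal (C * \<delta> powr p) * energy p \<theta> (Suc k) \<phi>"
      by (simp add: energy_def sum_lists_Suc sum_distrib_left)
    finally have "ennreal ((C * \<delta> powr p) ^ k) * energy p \<theta> k \<phi>
        \<le> ennreal ((C * \<delta> powr p) ^ k) * (ennreal (C * \<delta> powr p) * energy p \<theta> (Suc k) \<phi>)"
      by (intro mult_left_mono) auto
    also have "\<dots> = ennreal ((C * \<delta> powr p) ^ Suc k) * energy p \<theta> (Suc k) \<phi>"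
      using C(1) by (simp add: ennreal_mult'' mult_ac)
    finally show ?case using Suc.IH by (rule order_trans[rotated])
  qed
  with C(1) show ?thesis by blast
qed

text \<open>Absorption: if \<open>e k\<close> is small relative to \<open>e (k + 1)\<close>, inserting this into the inequality between
\<open>e k\<close>, \<open>e (k + 1)\<close>, \<open>e (k + 2)\<close> leaves at most half of \<open>e (k + 1)\<close> on the right.  The family \<open>S\<close> keeps
\<open>K\<close> independent of the individual sequence.\<close>

lemma interpolation_sequence_step:
  fixes S :: "(nat \<Rightarrow> real) set" and C :: real
  assumes C: "C > 0"
    and nonneg: "\<And>e k. e \<in> S \<Longrightarrow> 0 \<le> e k"
    and step: "\<And>e k t. e \<in> S \<Longrightarrow> t > 0 \<Longrightarrow> e (Suc k) \<le> C * t * e (Suc (Suc k)) + C / t * e k"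
    and "\<epsilon> > 0"
  shows "\<exists>K\<ge>0. \<forall>e\<in>S. e k \<le> \<epsilon> * e (Suc k) + K * e 0"
  using \<open>\<epsilon> > 0\<close>
proof (induction k arbitrary: \<epsilon>)
  case 0
  then show ?case using nonneg by (intro exI[of _ 1]) auto
next
  case (Suc k)
  \<comment> \<open>\<open>t\<close> makes the coefficient of \<open>e (k + 2)\<close> equal to \<open>\<epsilon> / 2\<close>; absorbing half of the left side doubles it.\<close>
  define t where "t = \<epsilon> / (2 * C)"
  define D where "D = C / t"
  have t: "t > 0" "D > 0" using C Suc.prems by (auto simp: t_def D_def)
  obtain K where K: "K \<ge> 0" "\<And>e. e \<in> S \<Longrightarrow> e k \<le> 1 / (2 * D) * e (Suc k) + K * e 0"
    using Suc.IH[of "1 / (2 * D)"] t by auto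
  have "e (Suc k) \<le> \<epsilon> * e (Suc (Suc k)) + (2 * D * K) * e 0" if "e \<in> S" for e
  proof -
    have "e (Suc k) \<le> \<epsilon> / 2 * e (Suc (Suc k)) + D * e k"
      using step[OF that t(1), of k] C by (simp add: t_def D_def)
    also have "D * e k \<le> D * (1 / (2 * D) * e (Suc k) + K * e 0)"
      using t K(2)[OF that] by (intro mult_left_mono) auto
    also have "\<dots> = e (Suc k) / 2 + D * K * e 0" using t by (simp add: field_simps)
    finally show ?thesis by simp
  qed
  then show ?case using K(1) t by (intro exI[of _ "2 * D * K"]) auto
qed

lemma interpolation_sequence:
  fixes S :: "(nat \<Rightarrow> real) set" and C :: real
  assumes C: "C > 0"
    and nonneg: "\<And>e k. e \<in> S \<Longrightarrow> 0 \<le> e k"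
    and step: "\<And>e k t. e \<in> S \<Longrightarrow> t > 0 \<Longrightarrow> e (Suc k) \<le> C * t * e (Suc (Suc k)) + C / t * e k"
    and "k < m" "\<epsilon> > 0"
  shows "\<exists>K\<ge>0. \<forall>e\<in>S. e k \<le> \<epsilon> * e m + K * e 0"
  using \<open>k < m\<close> \<open>\<epsilon> > 0\<close>
proof (induction m arbitrary: \<epsilon>)
  case 0
  then show ?case by simp
next
  case (Suc m)
  obtain K where K: "K \<ge> 0" "\<And>e. e \<in> S \<Longrightarrow> e m \<le> \<epsilon> * e (Suc m) + K * e 0"
    using interpolation_sequence_step[where S = S and C = C and k = m and \<epsilon> = \<epsilon>]
      C nonneg step Suc.prems(2) by blast
  show ?case
  proof (cases "k = m")
    case True
    with K show ?thesis by blast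
  next
    case False
    then obtain K' where K': "K' \<ge> 0" "\<And>e. e \<in> S \<Longrightarrow> e k \<le> 1 * e m + K' * e 0"
      using Suc.IH[of 1] Suc.prems(1) by auto
    have "e k \<le> \<epsilon> * e (Suc m) + (K + K') * e 0" if "e \<in> S" for e
      using K(2)[OF that] K'(2)[OF that] by (simp add: algebra_simps)
    then show ?thesis using K(1) K'(1) by (intro exI[of _ "K + K'"]) auto
  qed
qed

text \<open>The first-order inequality with \<open>t = r\<^sup>p\<close>, applied to all derivatives of order \<open>k\<close>, is the hypothesis of
\<open>interpolation_sequence\<close>.  Absorption takes place in the reals, which is where the finiteness of the
energies of test functions enters.\<close>

lemma weighted_interpolation:
  assumes p: "1 \<le> p" and \<theta>: "- real CARD('n) < \<theta>" "\<theta> \<le> 0" and "k < m" "\<epsilon> > 0"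
  shows "\<exists>K\<ge>0. \<forall>\<phi>\<in>test_functions (UNIV :: (real ^ 'n) set).
     energy p \<theta> k \<phi> \<le> ennreal \<epsilon> * energy p \<theta> m \<phi> + ennreal K * energy p \<theta> 0 \<phi>"
proof -
  define T where "T = test_functions (UNIV :: (real ^ 'n) set)"
  define e where "e \<phi> k = enn2real (energy p \<theta> k \<phi>)" for k and \<phi> :: "real ^ 'n \<Rightarrow> real"
  have e: "energy p \<theta> k \<phi> = ennreal (e \<phi> k)" if "\<phi> \<in> T" for k \<phi>
    using energy_test_function_finite[OF _ \<theta>, of p \<phi> UNIV k] p that
    by (simp add: e_def T_def)
  have e_nonneg: "0 \<le> e \<phi> k" for \<phi> k by (simp add: e_def)
  obtain C where C: "C > 0" "\<And>r \<phi>. r > 0 \<Longrightarrow> smooth (\<phi> :: real ^ 'n \<Rightarrow> real) \<Longrightarrow>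
     (\<Sum>i\<in>UNIV. Lp_power p (power_weight \<theta>) (partial_deriv i \<phi>)) \<le>
       ennreal (C * r powr p) *
         (\<Sum>i\<in>UNIV. \<Sum>j\<in>UNIV. Lp_power p (power_weight \<theta>) (partial_deriv j (partial_deriv i \<phi>)))
       + ennreal (C / r powr p) * Lp_power p (power_weight \<theta>) \<phi>"
    using weighted_interpolation_first_order[OF p \<theta>] by blast
  have step: "e \<phi> (Suc k) \<le> C * t * e \<phi> (Suc (Suc k)) + C / t * e \<phi> k" if \<phi>: "\<phi> \<in> T" and t: "t > 0" for \<phi> k t
  proof -
    define r where "r = t powr (1 / p)"
    have r: "r > 0" "r powr p = t" using t p by (auto simp: r_def powr_powr)
    have sm: "smooth \<phi>" using \<phi> test_functions_smooth by (auto simp: T_def)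
    have "energy p \<theta> (Suc k) \<phi> = (\<Sum>ix | length ix = k.
        \<Sum>i\<in>UNIV. Lp_power p (power_weight \<theta>) (partial_deriv i (iter_partial ix \<phi>)))"
      by (simp add: energy_def sum_lists_Suc)
    also have "\<dots> \<le> (\<Sum>ix | length ix = k. ennreal (C * t) *
         (\<Sum>i\<in>UNIV. \<Sum>j\<in>UNIV. Lp_power p (power_weight \<theta>) (partial_deriv j (partial_deriv i (iter_partial ix \<phi>))))
       + ennreal (C / t) * Lp_power p (power_weight \<theta>) (iter_partial ix \<phi>))"
      using C(2)[OF r(1) smooth_iter_partial[OF sm]] unfolding r(2) by (intro sum_mono)
    also have "\<dots> = ennreal (C * t) * energy p \<theta> (Suc (Suc k)) \<phi> + ennreal (C / t) * energy p \<theta> k \<phi>"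
      by (simp add: energy_def sum_lists_Suc sum.distrib sum_distrib_left)
    finally have "ennreal (e \<phi> (Suc k)) \<le> ennreal (C * t) * ennreal (e \<phi> (Suc (Suc k))) + ennreal (C / t) * ennreal (e \<phi> k)"
      by (simp add: e[OF \<phi>])
    also have "\<dots> = ennreal (C * t * e \<phi> (Suc (Suc k)) + C / t * e \<phi> k)"
      using C(1) t e_nonneg by (simp add: ennreal_mult[symmetric] ennreal_plus[symmetric] del: ennreal_plus)
    finally show ?thesis
      using C(1) t e_nonneg by (subst (asm) ennreal_le_iff) auto
  qed
  obtain K where K: "K \<ge> 0" "\<And>\<phi>. \<phi> \<in> T \<Longrightarrow> e \<phi> k \<le> \<epsilon> * e \<phi> m + K * e \<phi> 0"
  proof -
    have "\<exists>K\<ge>0. \<forall>a\<in>e ` T. a k \<le> \<epsilon> * a m + K * a 0"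
      by (rule interpolation_sequence[OF C(1)]) (use e_nonneg step \<open>k < m\<close> \<open>\<epsilon> > 0\<close> in auto)
    then show ?thesis using that by auto
  qed
  have "energy p \<theta> k \<phi> \<le> ennreal \<epsilon> * energy p \<theta> m \<phi> + ennreal K * energy p \<theta> 0 \<phi>" if "\<phi> \<in> T" for \<phi>
  proof -
    have "ennreal (e \<phi> k) \<le> ennreal (\<epsilon> * e \<phi> m + K * e \<phi> 0)"
      by (intro ennreal_leI K(2) that)
    also have "\<dots> = ennreal \<epsilon> * ennreal (e \<phi> m) + ennreal K * ennreal (e \<phi> 0)"
      using \<open>\<epsilon> > 0\<close> K(1) e_nonneg by (simp add: ennreal_mult)
    finally show ?thesis by (simp add: e[OF that])
  qed
  with K(1) show ?thesis unfolding T_def by blast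
qed

lemma weighted_interpolation_lower_order:
  assumes p: "1 \<le> p" and \<theta>: "- real CARD('n) < \<theta>" "\<theta> \<le> 0" and "0 < m" "\<epsilon> > 0"
  shows "\<exists>K\<ge>0. \<forall>\<phi>\<in>test_functions (UNIV :: (real ^ 'n) set).
     (\<Sum>k<m. energy p \<theta> k \<phi>) \<le> ennreal \<epsilon> * energy p \<theta> m \<phi> + ennreal K * energy p \<theta> 0 \<phi>"
proof -
  have "\<forall>k\<in>{..<m}. \<exists>K\<ge>0. \<forall>\<phi>\<in>test_functions (UNIV :: (real ^ 'n) set).
     energy p \<theta> k \<phi> \<le> ennreal (\<epsilon> / m) * energy p \<theta> m \<phi> + ennreal K * energy p \<theta> 0 \<phi>"
    using weighted_interpolation[OF p \<theta>, of _ m "\<epsilon> / m"] assms(4,5) by simp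
  then obtain K where K: "\<And>k. k < m \<Longrightarrow> K k \<ge> 0"
    "\<And>k \<phi>. k < m \<Longrightarrow> \<phi> \<in> test_functions (UNIV :: (real ^ 'n) set) \<Longrightarrow>
     energy p \<theta> k \<phi> \<le> ennreal (\<epsilon> / m) * energy p \<theta> m \<phi> + ennreal (K k) * energy p \<theta> 0 \<phi>"
    by (auto dest!: bchoice)
  have "(\<Sum>k<m. energy p \<theta> k \<phi>) \<le> ennreal \<epsilon> * energy p \<theta> m \<phi> + ennreal (\<Sum>k<m. K k) * energy p \<theta> 0 \<phi>"
    if "\<phi> \<in> test_functions UNIV" for \<phi> :: "real ^ 'n \<Rightarrow> real"
  proof -
    have "(\<Sum>k<m. energy p \<theta> k \<phi>) \<le> (\<Sum>k<m. ennreal (\<epsilon> / m) * energy p \<theta> m \<phi> + ennreal (K k) * energy p \<theta> 0 \<phi>)"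
      using that by (intro sum_mono K(2)) auto
    also have "\<dots> = of_nat m * ennreal (\<epsilon> / m) * energy p \<theta> m \<phi> + (\<Sum>k<m. ennreal (K k)) * energy p \<theta> 0 \<phi>"
      by (simp add: sum.distrib sum_distrib_right mult.assoc)
    also have "of_nat m * ennreal (\<epsilon> / m) = ennreal \<epsilon>"
      using assms(4,5) by (simp add: ennreal_of_nat_eq_real_of_nat ennreal_mult[symmetric])
    also have "(\<Sum>k<m. ennreal (K k)) = ennreal (\<Sum>k<m. K k)"
      using K(1) by (intro sum_ennreal) auto
    finally show ?thesis .
  qed
  moreover have "(\<Sum>k<m. K k) \<ge> 0" using K(1) by (intro sum_nonneg) auto
  ultimately show ?thesis by blast
qed

section \<open>Averaging over translated cut-off functions\<close>

lemma nn_integral_convolution: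
  fixes f g :: "'a::euclidean_space \<Rightarrow> ennreal"
  assumes [measurable]: "f \<in> borel_measurable borel" "g \<in> borel_measurable borel"
  shows "(\<integral>\<^sup>+a. (\<integral>\<^sup>+x. f x * g (x - a) \<partial>lborel) \<partial>lborel) = (\<integral>\<^sup>+x. f x \<partial>lborel) * (\<integral>\<^sup>+x. g x \<partial>lborel)"
proof -
  have "(\<integral>\<^sup>+a. (\<integral>\<^sup>+x. f x * g (x - a) \<partial>lborel) \<partial>lborel) = (\<integral>\<^sup>+x. (\<integral>\<^sup>+a. f x * g (x - a) \<partial>lborel) \<partial>lborel)"
    by (rule lborel_pair.Fubini') measurable
  also have "\<dots> = (\<integral>\<^sup>+x. f x * (\<integral>\<^sup>+a. g (x - a) \<partial>lborel) \<partial>lborel)"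
    by (rule nn_integral_cong, rule nn_integral_cmult) measurable
  also have "(\<lambda>x. \<integral>\<^sup>+a. g (x - a) \<partial>lborel) = (\<lambda>_. \<integral>\<^sup>+x. g x \<partial>lborel)"
    using nn_integral_lborel_affine[OF assms(2), of "- 1"] by auto
  also have "(\<integral>\<^sup>+x. f x * (\<integral>\<^sup>+x. g x \<partial>lborel) \<partial>lborel) = (\<integral>\<^sup>+x. f x \<partial>lborel) * (\<integral>\<^sup>+x. g x \<partial>lborel)"
    by (rule nn_integral_multc) measurable
  finally show ?thesis .
qed

lemma nn_integral_powr_test_function_finite:
  fixes f :: "real ^ 'n \<Rightarrow> real"
  assumes "0 \<le> p" "f \<in> test_functions \<Omega>"
  shows "(\<integral>\<^sup>+x. ennreal (\<bar>f x\<bar> powr p) \<partial>lborel) < \<infinity>"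
proof -
  have "(\<integral>\<^sup>+x. ennreal (\<bar>f x\<bar> powr p) \<partial>lborel) = Lp_power p (power_weight 0) f"
    unfolding Lp_power_power_weight
  proof (rule nn_integral_cong_AE)
    show "AE x in lborel. ennreal (\<bar>f x\<bar> powr p) = ennreal (\<bar>f x\<bar> powr p) * ennreal (power_weight 0 x)"
      using AE_lborel_singleton[of "0 :: real ^ 'n"]
      by eventually_elim (simp add: power_weight_def)
  qed
  also have "\<dots> < \<infinity>"
    using assms by (intro Lp_power_test_function_finite) auto
  finally show ?thesis .
qed

lemma nn_integral_powr_smooth_pos:
  fixes f :: "real ^ 'n \<Rightarrow> real"
  assumes sm: "smooth f" and "f x0 \<noteq> 0"
  shows "0 < (\<integral>\<^sup>+x. ennreal (\<bar>f x\<bar> powr p) \<partial>lborel)"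
proof (rule ccontr)
  have [measurable]: "f \<in> borel_measurable borel" by (rule smooth_borel[OF sm])
  assume "\<not> ?thesis"
  then have "(\<integral>\<^sup>+x. ennreal (\<bar>f x\<bar> powr p) \<partial>lborel) = 0" by simp
  then have "AE x in lborel. ennreal (\<bar>f x\<bar> powr p) = 0"
    by (subst (asm) nn_integral_0_iff_AE) auto
  then have "AE x in lborel. f x = 0" by eventually_elim (auto simp: ennreal_eq_0_iff)
  then have "{x. f x \<noteq> 0} \<in> null_sets lborel"
    by (subst AE_iff_null_sets) auto
  then have "negligible {x. f x \<noteq> 0}"
    by (simp add: negligible_iff_null_sets null_sets_completionI)
  moreover have "open {x. f x \<noteq> 0}"
    by (intro open_Collect_neq smooth_continuous_on sm continuous_on_const)
  ultimately show False using open_not_negligible assms(2) by blast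
qed

text \<open>Order \<open>m\<close> of the product, integrated over all translations of the cut-off.  By Tonelli's theorem each
Leibniz term \<open>\<partial>\<^sup>j \<phi> \<cdot> \<partial>\<^sup>k \<psi>(\<cdot> - a)\<close> turns into the product of \<open>\<parallel>\<partial>\<^sup>j \<phi>\<parallel>\<^sup>p\<close> and the unweighted integral of
\<open>|\<partial>\<^sup>k \<psi>|\<^sup>p\<close>.  The order of the quantifiers is the point: \<open>B\<close>, which belongs to the terms of top order in
\<open>\<phi>\<close>, is independent of \<open>\<psi>\<close>, whereas \<open>K\<close> depends on it.  The factor \<open>c\<close> stands inside the integral so
that the measurability of the integrand in \<open>a\<close> is a matter of this proof alone.\<close>

lemma averaged_energy_of_product:
  assumes p: "1 \<le> p"
  shows "\<exists>B>0. \<forall>\<psi>\<in>test_functions (UNIV :: (real ^ 'n) set). \<exists>K<\<infinity>. \<forall>\<phi>\<in>test_functions UNIV. \<forall>c.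
    (\<integral>\<^sup>+a. c * energy p \<theta> m (\<lambda>x. \<phi> x * \<psi> (x - a)) \<partial>lborel)
      \<le> c * (ennreal B * (\<integral>\<^sup>+x. ennreal (\<bar>\<psi> x\<bar> powr p) \<partial>lborel) * energy p \<theta> m \<phi>
             + K * (\<Sum>k<m. energy p \<theta> k \<phi>))"
proof -
  let ?w = "\<lambda>x :: real ^ 'n. ennreal (power_weight \<theta> x)"
  let ?L = "Lp_power p (power_weight \<theta>)"
  let ?I = "{ix :: 'n list. length ix = m}"
  obtain L :: "'n list \<Rightarrow> ('n list \<times> 'n list) list" where
    L: "\<And>ix j k. (j, k) \<in> set (L ix) \<Longrightarrow> length j < length ix"
    "\<And>ix f g. smooth f \<Longrightarrow> smooth g \<Longrightarrow> iter_partial ix (\<lambda>x :: real ^ 'n. f x * g x) =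
        (\<lambda>x. iter_partial ix f x * g x + (\<Sum>(jx, kx)\<leftarrow>L ix. iter_partial jx f x * iter_partial kx g x))"
    using choice[OF allI[OF Leibniz_iter_partial]] by (fastforce simp: split_beta)
  \<comment> \<open>All Leibniz terms in one list, the leading one first.\<close>
  define T where "T ix = (ix, []) # L ix" for ix
  define t where "t ix = real (length (T ix)) powr p" for ix
  define B where "B = (\<Sum>ix\<in>?I. t ix)"
  have t_pos: "t ix > 0" for ix by (simp add: t_def T_def)
  have "replicate m undefined \<in> ?I" by simp
  then have "?I \<noteq> {}" by blast
  then have "B > 0" unfolding B_def by (intro sum_pos finite_lists_of_length t_pos)
  moreover have "\<exists>K<\<infinity>. \<forall>\<phi>\<in>test_functions UNIV. \<forall>c.
    (\<integral>\<^sup>+a. c * energy p \<theta> m (\<lambda>x. \<phi> x * \<psi> (x - a)) \<partial>lborel)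
      \<le> c * (ennreal B * (\<integral>\<^sup>+x. ennreal (\<bar>\<psi> x\<bar> powr p) \<partial>lborel) * energy p \<theta> m \<phi>
             + K * (\<Sum>k<m. energy p \<theta> k \<phi>))"
    if \<psi>: "\<psi> \<in> test_functions UNIV" for \<psi> :: "real ^ 'n \<Rightarrow> real"
  proof -
    define M where "M k = (\<integral>\<^sup>+x. ennreal (\<bar>iter_partial k \<psi> x\<bar> powr p) \<partial>lborel)" for k
    have M: "M k < \<infinity>" for k
      unfolding M_def using p
      by (intro nn_integral_powr_test_function_finite[OF _ test_functions_iter_partial[OF \<psi>]]) auto
    define K where "K = (\<Sum>ix\<in>?I. ennreal (t ix) * (\<Sum>i<length (L ix). M (snd (L ix ! i))))"
    have "K < \<infinity>"
      unfolding K_def using M by (simp add: finite_lists_of_length ennreal_mult_less_top)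
    moreover have "(\<integral>\<^sup>+a. c * energy p \<theta> m (\<lambda>x. \<phi> x * \<psi> (x - a)) \<partial>lborel)
      \<le> c * (ennreal B * M [] * energy p \<theta> m \<phi> + K * (\<Sum>k<m. energy p \<theta> k \<phi>))"
      if \<phi>: "\<phi> \<in> test_functions UNIV" for \<phi> c
    proof -
      note sm = test_functions_smooth[OF \<phi>] test_functions_smooth[OF \<psi>]
      have [measurable]: "iter_partial k \<phi> \<in> borel_measurable borel"
        "iter_partial k \<psi> \<in> borel_measurable borel" for k
        by (intro smooth_borel smooth_iter_partial sm)+
      define J where "J jk a = (\<integral>\<^sup>+x. (ennreal (\<bar>iter_partial (fst jk) \<phi> x\<bar> powr p) * ?w x)
          * ennreal (\<bar>iter_partial (snd jk) \<psi> (x - a)\<bar> powr p) \<partial>lborel)" for jk a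
      have [measurable]: "J jk \<in> borel_measurable borel" for jk
        unfolding J_def by measurable
      have J: "(\<integral>\<^sup>+a. J jk a \<partial>lborel) = ?L (iter_partial (fst jk) \<phi>) * M (snd jk)" for jk
        unfolding J_def M_def Lp_power_power_weight by (rule nn_integral_convolution) measurable
      have pointwise: "?L (iter_partial ix (\<lambda>x. \<phi> x * \<psi> (x - a)))
          \<le> ennreal (t ix) * (\<Sum>i<length (T ix). J (T ix ! i) a)" for ix a
      proof -
        let ?f = "\<lambda>i x. iter_partial (fst (T ix ! i)) \<phi> x * iter_partial (snd (T ix ! i)) \<psi> (x - a)"
        have eq: "iter_partial ix (\<lambda>x. \<phi> x * \<psi> (x - a)) x = (\<Sum>i<length (T ix). ?f i x)" for x
        proof -
          have "iter_partial ix (\<lambda>x. \<phi> x * \<psi> (x - a)) x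
             = (\<Sum>(j, k)\<leftarrow>T ix. iter_partial j \<phi> x * iter_partial k \<psi> (x - a))"
            using L(2)[OF sm(1) smooth_translate[OF sm(2)]] by (simp add: T_def iter_partial_translate)
          then show ?thesis
            by (simp add: sum_list_sum_nth atLeast0LessThan case_prod_unfold)
        qed
        have "?L (iter_partial ix (\<lambda>x. \<phi> x * \<psi> (x - a)))
           \<le> (\<integral>\<^sup>+x. ennreal (t ix) * (\<Sum>i<length (T ix). (ennreal (\<bar>iter_partial (fst (T ix ! i)) \<phi> x\<bar> powr p) * ?w x)
          * ennreal (\<bar>iter_partial (snd (T ix ! i)) \<psi> (x - a)\<bar> powr p)) \<partial>lborel)"
          unfolding Lp_power_power_weight
        proof (rule nn_integral_mono)
          fix x
          have "\<bar>\<Sum>i<length (T ix). ?f i x\<bar> powr p \<le> (\<Sum>i<length (T ix). \<bar>?f i x\<bar>) powr p"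
            using p by (intro powr_mono2 sum_abs) auto
          also have "\<dots> \<le> t ix * (\<Sum>i<length (T ix). \<bar>?f i x\<bar> powr p)"
            unfolding t_def using p powr_sum_le[of "{..<length (T ix)}" "\<lambda>i. \<bar>?f i x\<bar>" p] by simp
          finally have "ennreal (\<bar>\<Sum>i<length (T ix). ?f i x\<bar> powr p)
              \<le> ennreal (t ix * (\<Sum>i<length (T ix). \<bar>?f i x\<bar> powr p))"
            by (rule ennreal_leI)
          also have "\<dots> = ennreal (t ix) * (\<Sum>i<length (T ix). ennreal (\<bar>?f i x\<bar> powr p))"
            using t_pos[of ix] by (simp add: ennreal_mult sum_nonneg)
          also have "\<dots> = ennreal (t ix) * (\<Sum>i<length (T ix). ennreal (\<bar>iter_partial (fst (T ix ! i)) \<phi> x\<bar> powr p)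
              * ennreal (\<bar>iter_partial (snd (T ix ! i)) \<psi> (x - a)\<bar> powr p))"
            by (simp add: abs_mult powr_mult ennreal_mult)
          finally have "ennreal (\<bar>\<Sum>i<length (T ix). ?f i x\<bar> powr p) * ?w x
              \<le> ennreal (t ix) * (\<Sum>i<length (T ix). ennreal (\<bar>iter_partial (fst (T ix ! i)) \<phi> x\<bar> powr p)
              * ennreal (\<bar>iter_partial (snd (T ix ! i)) \<psi> (x - a)\<bar> powr p)) * ?w x"
            by (rule mult_right_mono) simp
          then show "ennreal (\<bar>iter_partial ix (\<lambda>x. \<phi> x * \<psi> (x - a)) x\<bar> powr p) * ?w x
            \<le> ennreal (t ix) * (\<Sum>i<length (T ix). (ennreal (\<bar>iter_partial (fst (T ix ! i)) \<phi> x\<bar> powr p) * ?w x)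
              * ennreal (\<bar>iter_partial (snd (T ix ! i)) \<psi> (x - a)\<bar> powr p))"
            by (simp add: eq sum_distrib_left sum_distrib_right mult_ac)
        qed
        also have "\<dots> = ennreal (t ix) * (\<integral>\<^sup>+x. (\<Sum>i<length (T ix). (ennreal (\<bar>iter_partial (fst (T ix ! i)) \<phi> x\<bar> powr p) * ?w x)
          * ennreal (\<bar>iter_partial (snd (T ix ! i)) \<psi> (x - a)\<bar> powr p)) \<partial>lborel)"
          by (rule nn_integral_cmult) measurable
        also have "\<dots> = ennreal (t ix) * (\<Sum>i<length (T ix). J (T ix ! i) a)"
          unfolding J_def by (subst nn_integral_sum) auto
        finally show ?thesis .
      qed
      have "(\<integral>\<^sup>+a. c * energy p \<theta> m (\<lambda>x. \<phi> x * \<psi> (x - a)) \<partial>lborel)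
          \<le> (\<integral>\<^sup>+a. c * (\<Sum>ix\<in>?I. ennreal (t ix) * (\<Sum>i<length (T ix). J (T ix ! i) a)) \<partial>lborel)"
        unfolding energy_def by (intro nn_integral_mono mult_left_mono sum_mono pointwise) auto
      also have "\<dots> = c * (\<integral>\<^sup>+a. (\<Sum>ix\<in>?I. ennreal (t ix) * (\<Sum>i<length (T ix). J (T ix ! i) a)) \<partial>lborel)"
        by (rule nn_integral_cmult) measurable
      also have "(\<integral>\<^sup>+a. (\<Sum>ix\<in>?I. ennreal (t ix) * (\<Sum>i<length (T ix). J (T ix ! i) a)) \<partial>lborel)
          = (\<Sum>ix\<in>?I. ennreal (t ix) * (\<Sum>i<length (T ix). ?L (iter_partial (fst (T ix ! i)) \<phi>) * M (snd (T ix ! i))))"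
        by (simp add: nn_integral_sum nn_integral_cmult J)
      also have "\<dots> \<le> (\<Sum>ix\<in>?I. ennreal B * M [] * ?L (iter_partial ix \<phi>)
          + ennreal (t ix) * (\<Sum>i<length (L ix). M (snd (L ix ! i))) * (\<Sum>k<m. energy p \<theta> k \<phi>))"
      proof (rule sum_mono)
        fix ix assume ix: "ix \<in> ?I"
        have low: "?L (iter_partial (fst (L ix ! i)) \<phi>) \<le> (\<Sum>k<m. energy p \<theta> k \<phi>)" if "i < length (L ix)" for i
        proof -
          have "length (fst (L ix ! i)) < m"
            using L(1)[of "fst (L ix ! i)" "snd (L ix ! i)" ix] that ix by simp
          then have "energy p \<theta> (length (fst (L ix ! i))) \<phi> \<le> (\<Sum>k<m. energy p \<theta> k \<phi>)"
            by (intro member_le_sum) auto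
          then show ?thesis using Lp_power_le_energy[OF refl] order_trans by blast
        qed
        have "t ix \<le> B" unfolding B_def using ix t_pos
          by (intro member_le_sum) (auto simp: finite_lists_of_length less_imp_le)
        have "ennreal (t ix) * (\<Sum>i<length (T ix). ?L (iter_partial (fst (T ix ! i)) \<phi>) * M (snd (T ix ! i)))
            = ennreal (t ix) * (?L (iter_partial ix \<phi>) * M [])
              + ennreal (t ix) * (\<Sum>i<length (L ix). ?L (iter_partial (fst (L ix ! i)) \<phi>) * M (snd (L ix ! i)))"
          by (simp add: T_def sum.lessThan_Suc_shift distrib_left del: sum.lessThan_Suc)
        also have "\<dots> \<le> ennreal B * (?L (iter_partial ix \<phi>) * M [])
              + ennreal (t ix) * (\<Sum>i<length (L ix). (\<Sum>k<m. energy p \<theta> k \<phi>) * M (snd (L ix ! i)))"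
          using low \<open>t ix \<le> B\<close>
          by (intro add_mono mult_mono mult_left_mono sum_mono mult_right_mono ennreal_leI) auto
        also have "\<dots> = ennreal B * M [] * ?L (iter_partial ix \<phi>)
          + ennreal (t ix) * (\<Sum>i<length (L ix). M (snd (L ix ! i))) * (\<Sum>k<m. energy p \<theta> k \<phi>)"
          unfolding sum_distrib_left[symmetric] by (simp only: mult_ac)
        finally show "ennreal (t ix) * (\<Sum>i<length (T ix). ?L (iter_partial (fst (T ix ! i)) \<phi>) * M (snd (T ix ! i)))
            \<le> ennreal B * M [] * ?L (iter_partial ix \<phi>)
          + ennreal (t ix) * (\<Sum>i<length (L ix). M (snd (L ix ! i))) * (\<Sum>k<m. energy p \<theta> k \<phi>)" .
      qed
      also have "\<dots> = ennreal B * M [] * energy p \<theta> m \<phi> + K * (\<Sum>k<m. energy p \<theta> k \<phi>)"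
        unfolding K_def energy_def[of _ _ m]
        by (simp only: sum.distrib sum_distrib_left[symmetric] sum_distrib_right[symmetric])
      finally show ?thesis by (simp add: mult_left_mono)
    qed
    moreover have M_Nil: "(\<integral>\<^sup>+x. ennreal (\<bar>\<psi> x\<bar> powr p) \<partial>lborel) = M []" by (simp add: M_def)
    ultimately show ?thesis unfolding M_Nil by (intro exI[of _ K] conjI ballI allI)
  qed
  ultimately show ?thesis by blast
qed

section \<open>The equivalence of the global and the localized bound\<close>

lemma Lp_power_cmult:
  fixes f :: "real ^ 'n \<Rightarrow> real"
  assumes [measurable]: "f \<in> borel_measurable borel"
  shows "Lp_power p (power_weight \<theta>) (\<lambda>x. c * f x) = ennreal (\<bar>c\<bar> powr p) * Lp_power p (power_weight \<theta>) f"
proof -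
  have "Lp_power p (power_weight \<theta>) (\<lambda>x. c * f x) = (\<integral>\<^sup>+x. ennreal (\<bar>c\<bar> powr p)
      * (ennreal (\<bar>f x\<bar> powr p) * ennreal (power_weight \<theta> x)) \<partial>lborel)"
    unfolding Lp_power_power_weight
    by (intro nn_integral_cong) (simp add: abs_mult powr_mult ennreal_mult mult.assoc)
  also have "\<dots> = ennreal (\<bar>c\<bar> powr p) * Lp_power p (power_weight \<theta>) f"
    unfolding Lp_power_power_weight by (rule nn_integral_cmult) measurable
  finally show ?thesis .
qed

lemma Lp_norm_le_iff:
  assumes p: "0 < p" and c: "0 \<le> c"
  shows "Lp_norm p w f \<le> ennreal c \<longleftrightarrow> Lp_power p w f \<le> ennreal (c powr p)"
proof (cases "Lp_power p w f")
  case (real q)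
  have "q powr (1 / p) \<le> c \<longleftrightarrow> q \<le> c powr p"
  proof
    assume "q powr (1 / p) \<le> c"
    then have "(q powr (1 / p)) powr p \<le> c powr p" using p by (intro powr_mono2) auto
    then show "q \<le> c powr p" using p real(1) by (simp add: powr_powr)
  next
    assume "q \<le> c powr p"
    then have "q powr (1 / p) \<le> (c powr p) powr (1 / p)" using p real(1) by (intro powr_mono2) auto
    then show "q powr (1 / p) \<le> c" using p c by (simp add: powr_powr)
  qed
  with real c show ?thesis by (simp add: Lp_norm_def)
qed (simp add: Lp_norm_def top_unique)

lemma grad_norm_cmult:
  assumes "smooth f"
  shows "grad_norm m (\<lambda>x. c * f x) = (\<lambda>x. \<bar>c\<bar> * grad_norm m f x)"
proof
  fix x
  have "L2_set (\<lambda>ix. c * iter_partial ix f x) A = \<bar>c\<bar> * L2_set (\<lambda>ix. iter_partial ix f x) A" for A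
    by (simp add: L2_set_def power_mult_distrib sum_distrib_left[symmetric] real_sqrt_mult)
  then show "grad_norm m (\<lambda>x. c * f x) x = \<bar>c\<bar> * grad_norm m f x"
    by (simp add: grad_norm_def iter_partial_cmult[OF assms])
qed

lemma grad_norm_borel:
  fixes f :: "real ^ 'n \<Rightarrow> real"
  assumes "smooth f"
  shows "grad_norm m f \<in> borel_measurable borel"
proof -
  have [measurable]: "iter_partial ix f \<in> borel_measurable borel" for ix
    by (intro smooth_borel smooth_iter_partial assms)
  show ?thesis unfolding grad_norm_def L2_set_def by measurable
qed

text \<open>With \<open>\<epsilon> = \<eta>\<^sup>p / 2\<close> the gradient term accounts for at most half of \<open>\<eta>\<^sup>p\<close>; by the Poincare inequality the
remaining term is of the order \<open>C(\<epsilon>) \<delta>\<^sup>m\<^sup>p\<close> and falls below the other half as \<open>\<delta>\<close> tends to \<open>0\<close>.\<close>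

lemma localized_bound_of_global_bound:
  fixes V :: "real ^ 'n \<Rightarrow> real"
  assumes p: "1 \<le> p" and m: "0 < m" and \<theta>: "- real CARD('n) < \<theta>" "\<theta> \<le> 0"
    and global: "\<And>\<epsilon>. \<epsilon> > 0 \<Longrightarrow> \<exists>C>0. \<forall>\<phi>\<in>test_functions (UNIV :: (real ^ 'n) set).
        Lp_power p (power_weight \<theta>) (\<lambda>x. V x * \<phi> x)
          \<le> ennreal \<epsilon> * Lp_power p (power_weight \<theta>) (grad_norm m \<phi>)
             + ennreal C * Lp_power p (power_weight \<theta>) \<phi>"
  shows "((\<lambda>\<delta>::real. SUP x0 :: real ^ 'n.
          SUP \<phi> \<in> {\<phi> \<in> test_functions (ball x0 \<delta>).
                      Lp_norm p (power_weight \<theta>) (grad_norm m \<phi>) \<le> 1}.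
            Lp_norm p (power_weight \<theta>) (\<lambda>x. V x * \<phi> x)) \<longlongrightarrow> 0) (at_right 0)"
    (is "(?S \<longlongrightarrow> 0) _")
proof (rule order_tendstoI)
  fix a :: ennreal assume "a < 0"
  then show "\<forall>\<^sub>F \<delta> in at_right 0. a < ?S \<delta>" by simp
next
  let ?L = "Lp_power p (power_weight \<theta>)"
  let ?N = "multi_index_count TYPE('n) m"
  fix a :: ennreal assume "0 < a"
  then obtain b where b: "0 < b" "b < a" using dense by blast
  then have "b < top" by (metis less_le_trans top_greatest)
  then obtain \<eta> where \<eta>': "b = ennreal \<eta>" by (auto simp: less_top_ennreal)
  then have \<eta>: "\<eta> > 0" using b by simp
  define \<epsilon> where "\<epsilon> = \<eta> powr p / 2"
  have \<epsilon>: "\<epsilon> > 0" using \<eta> by (simp add: \<epsilon>_def)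
  obtain C where C: "C > 0" "\<And>\<phi>. \<phi> \<in> test_functions (UNIV :: (real ^ 'n) set) \<Longrightarrow>
        ?L (\<lambda>x. V x * \<phi> x) \<le> ennreal \<epsilon> * ?L (grad_norm m \<phi>) + ennreal C * ?L \<phi>"
    using global[OF \<epsilon>] by blast
  obtain C0 where C0: "C0 > 0" "\<And>k \<delta> x0 \<phi>. \<delta> > 0 \<Longrightarrow> \<phi> \<in> test_functions (ball (x0 :: real ^ 'n) \<delta>) \<Longrightarrow>
     ?L \<phi> \<le> ennreal ((C0 * \<delta> powr p) ^ k) * energy p \<theta> k \<phi>"
    using weighted_Poincare[OF p \<theta>] by blast
  have N: "?N > 0" by (rule multi_index_count_pos)
  have "((\<lambda>\<delta>::real. C * ((C0 * \<delta> powr p) ^ m * ?N)) \<longlongrightarrow> C * ((C0 * 0 powr p) ^ m * ?N)) (at_right 0)"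
    using p by (intro tendsto_intros tendsto_powr') (auto simp: eventually_at_filter)
  then have "((\<lambda>\<delta>::real. C * ((C0 * \<delta> powr p) ^ m * ?N)) \<longlongrightarrow> 0) (at_right 0)"
    using m by (simp add: power_0_left)
  then have "\<forall>\<^sub>F \<delta> in at_right 0. C * ((C0 * \<delta> powr p) ^ m * ?N) < \<epsilon>"
    using \<epsilon> by (rule order_tendstoD)
  moreover have "\<forall>\<^sub>F \<delta>::real in at_right 0. 0 < \<delta>" by (simp add: eventually_at_filter)
  ultimately show "\<forall>\<^sub>F \<delta> in at_right 0. ?S \<delta> < a"
  proof eventually_elim
    case (elim \<delta>)
    have "Lp_norm p (power_weight \<theta>) (\<lambda>x. V x * \<phi> x) \<le> ennreal \<eta>"
      if \<phi>: "\<phi> \<in> test_functions (ball x0 \<delta>)" and le: "Lp_norm p (power_weight \<theta>) (grad_norm m \<phi>) \<le> 1"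
      for \<phi> and x0 :: "real ^ 'n"
    proof -
      have grad: "?L (grad_norm m \<phi>) \<le> 1"
        using le Lp_norm_le_iff[of p 1 "power_weight \<theta>" "grad_norm m \<phi>"] p by simp
      have "?L \<phi> \<le> ennreal ((C0 * \<delta> powr p) ^ m) * energy p \<theta> m \<phi>"
        by (rule C0(2)[OF elim(2) \<phi>])
      also have "\<dots> \<le> ennreal ((C0 * \<delta> powr p) ^ m) * (ennreal ?N * ?L (grad_norm m \<phi>))"
        using p by (intro mult_left_mono energy_le_grad_norm) auto
      also have "\<dots> \<le> ennreal ((C0 * \<delta> powr p) ^ m) * (ennreal ?N * 1)"
        by (intro mult_left_mono grad) auto
      finally have small: "?L \<phi> \<le> ennreal ((C0 * \<delta> powr p) ^ m * ?N)"
        using C0(1) N by (simp add: ennreal_mult)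
      have "?L (\<lambda>x. V x * \<phi> x) \<le> ennreal \<epsilon> * ?L (grad_norm m \<phi>) + ennreal C * ?L \<phi>"
        using \<phi> test_functions_mono[of "ball x0 \<delta>" UNIV] by (intro C(2)) auto
      also have "\<dots> \<le> ennreal \<epsilon> * 1 + ennreal C * ennreal ((C0 * \<delta> powr p) ^ m * ?N)"
        by (intro add_mono mult_left_mono grad small) auto
      also have "\<dots> = ennreal (\<epsilon> + C * ((C0 * \<delta> powr p) ^ m * ?N))"
        using \<epsilon> C(1) C0(1) N by (simp add: ennreal_mult[symmetric] ennreal_plus[symmetric] del: ennreal_plus)
      also have "\<dots> \<le> ennreal (\<eta> powr p)"
        using elim(1) by (intro ennreal_leI) (simp add: \<epsilon>_def)
      finally show ?thesis
        using Lp_norm_le_iff[of p \<eta> "power_weight \<theta>" "\<lambda>x. V x * \<phi> x"] p \<eta> by simp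
    qed
    then have "?S \<delta> \<le> ennreal \<eta>" by (intro SUP_least) auto
    then show ?case using b \<eta>' by simp
  qed
qed

text \<open>Rescaling \<open>\<phi>\<close> removes the normalisation of the gradient.  Since the gradient norm might vanish, \<open>\<phi>\<close> is
divided by the \<open>p\<close>-th root of an arbitrary \<open>t > \<parallel>\<nabla>\<^sup>m \<phi>\<parallel>\<^sup>p\<close>.\<close>

lemma localized_bound_homogeneous:
  fixes V :: "real ^ 'n \<Rightarrow> real"
  assumes p: "1 \<le> p" and V [measurable]: "V \<in> borel_measurable borel" and \<eta>: "0 < \<eta>"
    and bound: "\<And>\<phi>. \<phi> \<in> test_functions \<Omega> \<Longrightarrow> Lp_norm p (power_weight \<theta>) (grad_norm m \<phi>) \<le> 1 \<Longrightarrow>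
       Lp_norm p (power_weight \<theta>) (\<lambda>x. V x * \<phi> x) \<le> ennreal \<eta>"
    and \<phi>: "\<phi> \<in> test_functions \<Omega>"
  shows "Lp_power p (power_weight \<theta>) (\<lambda>x. V x * \<phi> x)
    \<le> ennreal (\<eta> powr p) * Lp_power p (power_weight \<theta>) (grad_norm m \<phi>)"
proof (cases "Lp_power p (power_weight \<theta>) (grad_norm m \<phi>)")
  case top
  then show ?thesis using \<eta> by (simp add: ennreal_mult_top)
next
  case (real q)
  let ?L = "Lp_power p (power_weight \<theta>)"
  have sm: "smooth \<phi>" by (rule test_functions_smooth[OF \<phi>])
  have [measurable]: "\<phi> \<in> borel_measurable borel" by (rule smooth_borel[OF sm])
  have scaled: "?L (\<lambda>x. V x * \<phi> x) \<le> ennreal (\<eta> powr p * t)" if t: "t > q" for t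
  proof -
    define c where "c = (1 / t) powr (1 / p)"
    have t0: "t > 0" using t real by simp
    have c: "c > 0" "c powr p = 1 / t" using t0 p by (auto simp: c_def powr_powr)
    have "?L (grad_norm m (\<lambda>x. c * \<phi> x)) = ennreal (1 / t) * ennreal q"
      using c grad_norm_borel[OF sm, of m]
      by (simp add: grad_norm_cmult[OF sm] Lp_power_cmult real)
    also have "\<dots> \<le> 1"
      using t t0 real by (simp add: ennreal_mult[symmetric] ennreal_le_1)
    finally have "Lp_norm p (power_weight \<theta>) (grad_norm m (\<lambda>x. c * \<phi> x)) \<le> 1"
      using Lp_norm_le_iff[of p 1 "power_weight \<theta>" "grad_norm m (\<lambda>x. c * \<phi> x)"] p by simp
    then have "Lp_norm p (power_weight \<theta>) (\<lambda>x. V x * (c * \<phi> x)) \<le> ennreal \<eta>"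
      by (intro bound test_functions_cmult \<phi>)
    then have "?L (\<lambda>x. c * (V x * \<phi> x)) \<le> ennreal (\<eta> powr p)"
      using Lp_norm_le_iff[of p \<eta> "power_weight \<theta>" "\<lambda>x. V x * (c * \<phi> x)"] p \<eta>
      by (simp add: mult.left_commute)
    moreover have "?L (\<lambda>x. c * (V x * \<phi> x)) = ennreal (1 / t) * ?L (\<lambda>x. V x * \<phi> x)"
      using c by (subst Lp_power_cmult) auto
    ultimately have "?L (\<lambda>x. V x * \<phi> x) \<le> ennreal (\<eta> powr p / (1 / t))"
      using t0 by (intro ennreal_cmult_le_imp) auto
    then show ?thesis by simp
  qed
  have "?L (\<lambda>x. V x * \<phi> x) \<le> ennreal (\<eta> powr p * q)"
  proof (rule ennreal_le_epsilon)
    fix e :: real assume "e > 0"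
    then have "?L (\<lambda>x. V x * \<phi> x) \<le> ennreal (\<eta> powr p * (q + e / \<eta> powr p))"
      using \<eta> by (intro scaled) simp
    also have "\<eta> powr p * (q + e / \<eta> powr p) = \<eta> powr p * q + e"
      using \<eta> by (simp add: field_simps)
    finally show "?L (\<lambda>x. V x * \<phi> x) \<le> ennreal (\<eta> powr p * q) + ennreal e"
      using real \<open>e > 0\<close> by simp
  qed
  then show ?thesis using real by (simp add: ennreal_mult)
qed

text \<open>The constants are chosen in the order \<open>B\<close>, \<open>\<eta>\<close>, \<open>\<delta>\<close>, \<open>\<psi>\<close>, \<open>K\<close>, \<open>\<epsilon>'\<close>: the top-order constant \<open>B\<close> is known
before the cut-off, so \<open>\<eta>\<close> can make the top-order term at most half of \<open>\<epsilon>\<close>, and the interpolation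
inequality with a parameter \<open>\<epsilon>'\<close> adapted to \<open>K\<close> contributes at most the other half.\<close>

lemma global_bound_of_localized_bound:
  fixes V :: "real ^ 'n \<Rightarrow> real"
  assumes p: "1 \<le> p" and m: "0 < m" and \<theta>: "- real CARD('n) < \<theta>" "\<theta> \<le> 0"
    and V [measurable]: "V \<in> borel_measurable borel"
    and lim: "((\<lambda>\<delta>::real. SUP x0 :: real ^ 'n.
          SUP \<phi> \<in> {\<phi> \<in> test_functions (ball x0 \<delta>).
                      Lp_norm p (power_weight \<theta>) (grad_norm m \<phi>) \<le> 1}.
            Lp_norm p (power_weight \<theta>) (\<lambda>x. V x * \<phi> x)) \<longlongrightarrow> 0) (at_right 0)"
      (is "(?S \<longlongrightarrow> 0) _")
    and \<epsilon>: "\<epsilon> > 0"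
  shows "\<exists>C>0. \<forall>\<phi>\<in>test_functions (UNIV :: (real ^ 'n) set).
        Lp_power p (power_weight \<theta>) (\<lambda>x. V x * \<phi> x)
          \<le> ennreal \<epsilon> * Lp_power p (power_weight \<theta>) (grad_norm m \<phi>)
             + ennreal C * Lp_power p (power_weight \<theta>) \<phi>"
proof -
  let ?L = "Lp_power p (power_weight \<theta>)"
  define N where "N = multi_index_count TYPE('n) m"
  have N: "N > 0" unfolding N_def by (rule multi_index_count_pos)
  obtain B where B: "B > 0" "\<And>\<psi>. \<psi> \<in> test_functions (UNIV :: (real ^ 'n) set) \<Longrightarrow>
      \<exists>K<\<infinity>. \<forall>\<phi>\<in>test_functions UNIV. \<forall>c.
    (\<integral>\<^sup>+a. c * energy p \<theta> m (\<lambda>x. \<phi> x * \<psi> (x - a)) \<partial>lborel)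
      \<le> c * (ennreal B * (\<integral>\<^sup>+x. ennreal (\<bar>\<psi> x\<bar> powr p) \<partial>lborel) * energy p \<theta> m \<phi>
             + K * (\<Sum>k<m. energy p \<theta> k \<phi>))"
    using averaged_energy_of_product[OF p, where 'n = 'n, of \<theta> m] by blast
  \<comment> \<open>The two factors of \<open>N\<close> come from passing between \<open>\<nabla>\<^sup>m \<phi>\<close> and the energy, in both directions.\<close>
  define \<eta> where "\<eta> = (\<epsilon> / (2 * (N powr p * B * N))) powr (1 / p)"
  define D where "D = \<eta> powr p * N powr p"
  have D: "D * B * N = \<epsilon> / 2" and D_pos: "D > 0" and \<eta>: "\<eta> > 0"
    using \<epsilon> N B(1) p by (auto simp: D_def \<eta>_def powr_powr field_simps)
  have "\<forall>\<^sub>F \<delta> in at_right 0. ?S \<delta> < ennreal \<eta>"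
    using lim \<eta> by (intro order_tendstoD(2)) auto
  moreover have "\<forall>\<^sub>F \<delta>::real in at_right 0. 0 < \<delta>" by (simp add: eventually_at_filter)
  ultimately have "\<forall>\<^sub>F \<delta> in at_right 0. 0 < \<delta> \<and> ?S \<delta> < ennreal \<eta>"
    by eventually_elim simp
  then obtain \<delta> where \<delta>: "\<delta> > 0" "?S \<delta> < ennreal \<eta>"
    using eventually_happens[of _ "at_right (0 :: real)"] by (auto simp: trivial_limit_at_right_real)
  have unit: "Lp_norm p (power_weight \<theta>) (\<lambda>x. V x * \<phi> x) \<le> ennreal \<eta>"
    if "\<phi> \<in> test_functions (ball x0 \<delta>)" "Lp_norm p (power_weight \<theta>) (grad_norm m \<phi>) \<le> 1"
    for \<phi> and x0 :: "real ^ 'n"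
  proof -
    have "Lp_norm p (power_weight \<theta>) (\<lambda>x. V x * \<phi> x) \<le>
       (SUP \<phi> \<in> {\<phi> \<in> test_functions (ball x0 \<delta>).
          Lp_norm p (power_weight \<theta>) (grad_norm m \<phi>) \<le> 1}. Lp_norm p (power_weight \<theta>) (\<lambda>x. V x * \<phi> x))"
      using that by (intro SUP_upper) auto
    also have "\<dots> \<le> ?S \<delta>" by (intro SUP_upper) auto
    finally show ?thesis using \<delta>(2) by simp
  qed
  have local: "?L (\<lambda>x. V x * \<phi> x) \<le> ennreal D * energy p \<theta> m \<phi>"
    if "\<phi> \<in> test_functions (ball x0 \<delta>)" for \<phi> and x0 :: "real ^ 'n"
  proof -
    have "?L (\<lambda>x. V x * \<phi> x) \<le> ennreal (\<eta> powr p) * ?L (grad_norm m \<phi>)"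
      using unit that by (intro localized_bound_homogeneous[OF p V \<eta>]) auto
    also have "\<dots> \<le> ennreal (\<eta> powr p) * (ennreal (N powr p) * energy p \<theta> m \<phi>)"
      unfolding N_def using p that test_functions_smooth
      by (intro mult_left_mono grad_norm_le_energy) auto
    also have "\<dots> = ennreal D * energy p \<theta> m \<phi>"
      by (simp add: D_def ennreal_mult mult.assoc)
    finally show ?thesis .
  qed
  obtain \<psi> where \<psi>: "\<psi> \<in> test_functions (ball (0 :: real ^ 'n) \<delta>)" "\<psi> 0 \<noteq> 0"
    using exists_bump_function[OF \<delta>(1)] by blast
  have \<psi>_UNIV: "\<psi> \<in> test_functions UNIV" using \<psi>(1) test_functions_mono[of "ball 0 \<delta>" UNIV] by auto
  have [measurable]: "\<psi> \<in> borel_measurable borel"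
    by (rule smooth_borel[OF test_functions_smooth[OF \<psi>(1)]])
  define A where "A = enn2real (\<integral>\<^sup>+x. ennreal (\<bar>\<psi> x\<bar> powr p) \<partial>lborel)"
  have A': "(\<integral>\<^sup>+x. ennreal (\<bar>\<psi> x\<bar> powr p) \<partial>lborel) = ennreal A" and A: "A > 0"
    using nn_integral_powr_test_function_finite[of p \<psi>, OF _ \<psi>(1)] p
      nn_integral_powr_smooth_pos[OF test_functions_smooth[OF \<psi>(1)] \<psi>(2), of p]
    by (auto simp: A_def enn2real_positive_iff)
  obtain K' where K': "K' < \<infinity>" "\<And>\<phi> c. \<phi> \<in> test_functions (UNIV :: (real ^ 'n) set) \<Longrightarrow>
    (\<integral>\<^sup>+a. c * energy p \<theta> m (\<lambda>x. \<phi> x * \<psi> (x - a)) \<partial>lborel)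
      \<le> c * (ennreal B * ennreal A * energy p \<theta> m \<phi> + K' * (\<Sum>k<m. energy p \<theta> k \<phi>))"
    using B(2)[OF \<psi>_UNIV] unfolding A' by blast
  obtain K where K: "K \<ge> 0" "K' = ennreal K"
    using K'(1) by (auto simp: less_top_ennreal)
  have main: "?L (\<lambda>x. V x * \<phi> x) \<le> ennreal (D * B) * energy p \<theta> m \<phi> + ennreal (D * K / A) * (\<Sum>k<m. energy p \<theta> k \<phi>)"
    if \<phi>: "\<phi> \<in> test_functions (UNIV :: (real ^ 'n) set)" for \<phi>
  proof -
    have [measurable]: "\<phi> \<in> borel_measurable borel"
      by (rule smooth_borel[OF test_functions_smooth[OF \<phi>]])
    have "ennreal A * ?L (\<lambda>x. V x * \<phi> x) = (\<integral>\<^sup>+a. (\<integral>\<^sup>+x.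
        ennreal (\<bar>V x * \<phi> x\<bar> powr p) * ennreal (power_weight \<theta> x) * ennreal (\<bar>\<psi> (x - a)\<bar> powr p) \<partial>lborel) \<partial>lborel)"
      unfolding A'[symmetric] Lp_power_power_weight
      by (subst nn_integral_convolution[where g = "\<lambda>x. ennreal (\<bar>\<psi> x\<bar> powr p)"]) (auto simp: mult.commute)
    also have "\<dots> = (\<integral>\<^sup>+a. ?L (\<lambda>x. V x * (\<phi> x * \<psi> (x - a))) \<partial>lborel)"
      unfolding Lp_power_power_weight
      by (simp add: abs_mult powr_mult ennreal_mult mult_ac)
    also have "\<dots> \<le> (\<integral>\<^sup>+a. ennreal D * energy p \<theta> m (\<lambda>x. \<phi> x * \<psi> (x - a)) \<partial>lborel)"
      using test_functions_mult[OF \<phi> test_functions_translate[OF \<psi>(1)]]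
      by (intro nn_integral_mono local) auto
    also have "\<dots> \<le> ennreal D * (ennreal B * ennreal A * energy p \<theta> m \<phi> + K' * (\<Sum>k<m. energy p \<theta> k \<phi>))"
      by (rule K'(2)[OF \<phi>])
    also have "\<dots> = ennreal (D * B * A) * energy p \<theta> m \<phi> + ennreal (D * K) * (\<Sum>k<m. energy p \<theta> k \<phi>)"
      using D_pos B(1) A K by (simp add: distrib_left ennreal_mult mult.assoc)
    finally have "?L (\<lambda>x. V x * \<phi> x) \<le> ennreal (1 / A) *
        (ennreal (D * B * A) * energy p \<theta> m \<phi> + ennreal (D * K) * (\<Sum>k<m. energy p \<theta> k \<phi>))"
      using A by (intro ennreal_cmult_le_imp_le) auto
    also have "\<dots> = ennreal (1 / A * (D * B * A)) * energy p \<theta> m \<phi>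
        + ennreal (1 / A * (D * K)) * (\<Sum>k<m. energy p \<theta> k \<phi>)"
      using D_pos B(1) A K(1) by (subst (1 2) ennreal_mult) (auto simp: distrib_left mult.assoc)
    finally show ?thesis using A by simp
  qed
  define k where "k = D * K / A"
  have k: "k \<ge> 0" using D_pos K(1) A by (simp add: k_def)
  \<comment> \<open>\<open>k + 1\<close> rather than \<open>k\<close> since \<open>k\<close> may be zero.\<close>
  define \<epsilon>' where "\<epsilon>' = \<epsilon> / (2 * N * (k + 1))"
  have \<epsilon>': "\<epsilon>' > 0" using \<epsilon> N k by (simp add: \<epsilon>'_def)
  obtain Q where Q: "Q \<ge> 0" "\<And>\<phi>. \<phi> \<in> test_functions (UNIV :: (real ^ 'n) set) \<Longrightarrow>
     (\<Sum>k<m. energy p \<theta> k \<phi>) \<le> ennreal \<epsilon>' * energy p \<theta> m \<phi> + ennreal Q * energy p \<theta> 0 \<phi>"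
    using weighted_interpolation_lower_order[OF p \<theta> m \<epsilon>'] by blast
  have const: "(D * B + k * \<epsilon>') * N \<le> \<epsilon>"
  proof -
    have "N * \<epsilon>' = \<epsilon> / 2 / (k + 1)" using N by (simp add: \<epsilon>'_def)
    then have "k * \<epsilon>' * N = \<epsilon> / 2 * (k / (k + 1))"
      by (metis mult.commute mult.left_commute times_divide_eq_right)
    also have "\<dots> \<le> \<epsilon> / 2 * 1" using k \<epsilon> by (intro mult_left_mono) auto
    finally show ?thesis using D by (simp add: distrib_right)
  qed
  have "?L (\<lambda>x. V x * \<phi> x) \<le> ennreal \<epsilon> * ?L (grad_norm m \<phi>) + ennreal (k * Q + 1) * ?L \<phi>"
    if \<phi>: "\<phi> \<in> test_functions (UNIV :: (real ^ 'n) set)" for \<phi>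
  proof -
    have "?L (\<lambda>x. V x * \<phi> x) \<le> ennreal (D * B) * energy p \<theta> m \<phi> + ennreal k * (\<Sum>k<m. energy p \<theta> k \<phi>)"
      using main[OF \<phi>] by (simp add: k_def)
    also have "\<dots> \<le> ennreal (D * B) * energy p \<theta> m \<phi> + ennreal k * (ennreal \<epsilon>' * energy p \<theta> m \<phi> + ennreal Q * energy p \<theta> 0 \<phi>)"
      by (intro add_left_mono mult_left_mono Q(2) \<phi>) auto
    also have "\<dots> = ennreal (D * B + k * \<epsilon>') * energy p \<theta> m \<phi> + ennreal (k * Q) * ?L \<phi>"
      using D_pos B(1) k \<epsilon>' Q(1)
      by (simp add: energy_0 ennreal_mult distrib_left distrib_right mult.assoc add.assoc)
    also have "\<dots> \<le> ennreal (D * B + k * \<epsilon>') * (ennreal N * ?L (grad_norm m \<phi>)) + ennreal (k * Q + 1) * ?L \<phi>"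
      unfolding N_def using p
      by (intro add_mono mult_left_mono mult_right_mono energy_le_grad_norm ennreal_leI) auto
    also have "ennreal (D * B + k * \<epsilon>') * (ennreal N * ?L (grad_norm m \<phi>)) = ennreal ((D * B + k * \<epsilon>') * N) * ?L (grad_norm m \<phi>)"
      using D_pos B(1) k \<epsilon>' N by (subst ennreal_mult) (auto simp: mult.assoc)
    also have "\<dots> \<le> ennreal \<epsilon> * ?L (grad_norm m \<phi>)"
      by (intro mult_right_mono ennreal_leI const) auto
    finally show ?thesis by simp
  qed
  moreover have "k * Q + 1 > 0" using k Q(1) by (simp add: add_nonneg_pos)
  ultimately show ?thesis by blast
qed

text \<open>Tonelli's theorem is used on products of Borel measures, whereas \<open>V\<close> is only Lebesgue measurable; since
all norms are integrals, \<open>V\<close> can be exchanged for a Borel function equal to it almost everywhere.\<close>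

lemma locally_integrable_borel_representative:
  fixes V :: "real ^ 'n \<Rightarrow> real"
  assumes "locally_integrable V"
  shows "\<exists>V'\<in>borel_measurable borel. AE x in lebesgue. V x = V' x"
proof -
  have "(\<lambda>x. indicator (cball 0 (real k)) x * V x) \<in> borel_measurable lebesgue" for k
    using assms unfolding locally_integrable_def set_integrable_def
    by (metis (no_types, lifting) borel_measurable_integrable compact_cball ext real_scaleR_def)
  moreover have "(\<lambda>k. indicator (cball 0 (real k)) x * V x) \<longlonglongrightarrow> V x" for x :: "real ^ 'n"
  proof (rule tendsto_eventually)
    show "\<forall>\<^sub>F k in sequentially. indicator (cball 0 (real k)) x * V x = V x"
      using eventually_ge_at_top[of "nat \<lceil>norm x\<rceil>"]
      by eventually_elim (simp add: nat_le_iff ceiling_le_iff)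
  qed
  ultimately have "V \<in> borel_measurable lebesgue"
    by (rule borel_measurable_LIMSEQ_real[rotated])
  from completion_ex_borel_measurable_real[OF this]
  obtain V' where V': "V' \<in> borel_measurable lborel" "AE x in lborel. V x = V' x" by blast
  then show ?thesis by (auto intro!: bexI[of _ V'] AE_completion)
qed

theorem theorem1p4:
  fixes p \<theta> :: real and m :: nat and V :: "real ^ 'n \<Rightarrow> real"
  assumes "1 \<le> p"
    and "0 < m" and "m < CARD('n)"
    and "1 - real CARD('n) < \<theta>" and "\<theta> \<le> 0"
    and "locally_integrable V"
    and "AE x in lebesgue. 0 \<le> V x"
  shows
    "(\<forall>\<epsilon>>0. \<exists>C>0. \<forall>\<phi>\<in>test_functions (UNIV :: (real ^ 'n) set).
        Lp_power p (power_weight \<theta>) (\<lambda>x. V x * \<phi> x)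
          \<le> ennreal \<epsilon> * Lp_power p (power_weight \<theta>) (grad_norm m \<phi>)
             + ennreal C * Lp_power p (power_weight \<theta>) \<phi>)
     \<longleftrightarrow>
     ((\<lambda>\<delta>::real. SUP x0 :: real ^ 'n.
          SUP \<phi> \<in> {\<phi> \<in> test_functions (ball x0 \<delta>).
                      Lp_norm p (power_weight \<theta>) (grad_norm m \<phi>) \<le> 1}.
            Lp_norm p (power_weight \<theta>) (\<lambda>x. V x * \<phi> x))
        \<longlongrightarrow> 0) (at_right 0)"
proof -
  have \<theta>: "- real CARD('n) < \<theta>" using assms(4) by linarith
  obtain V' where V': "V' \<in> borel_measurable borel" "AE x in lebesgue. V x = V' x"
    using locally_integrable_borel_representative[OF assms(6)] by blast
  have power_eq: "Lp_power p (power_weight \<theta>) (\<lambda>x. V x * \<phi> x)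
      = Lp_power p (power_weight \<theta>) (\<lambda>x. V' x * \<phi> x)" for \<phi>
    unfolding Lp_power_def
  proof (rule nn_integral_cong_AE)
    show "AE x in lebesgue. ennreal (\<bar>V x * \<phi> x\<bar> powr p * power_weight \<theta> x)
        = ennreal (\<bar>V' x * \<phi> x\<bar> powr p * power_weight \<theta> x)"
      using V'(2) by eventually_elim simp
  qed
  then have norm_eq: "Lp_norm p (power_weight \<theta>) (\<lambda>x. V x * \<phi> x)
      = Lp_norm p (power_weight \<theta>) (\<lambda>x. V' x * \<phi> x)" for \<phi>
    by (simp add: Lp_norm_def)
  show ?thesis
    unfolding power_eq norm_eq
    using localized_bound_of_global_bound[OF assms(1,2) \<theta> assms(5), of V']
      global_bound_of_localized_bound[OF assms(1,2) \<theta> assms(5) V'(1)]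
    by blast
qed

end
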